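(* Let $0<\alpha<2$, let $T$ be an arbitrary index set, and let $\{X_t\}_{t\in T}$ be an S$\alpha$S process with representation $\{X_t\}_{t\in T}\stackrel{d}{=}\{\int_S f_t\,dM_{\alpha,+}\}_{t\in T}$, where $\{f_t\}_{t\in T}\subset L^\alpha(S,\mu)$ and $M_{\alpha,+}$ is an S$\alpha$S random measure on the $\sigma$-finite measure space $(S,\mu)$ with control measure $\mu$. Then $\{X_t\}_{t\in T}$ is max-associable if and only if for all $t_1,t_2\in T$, $$f_{t_1}(s)f_{t_2}(s)\ge 0\quad\text{for }\mu\text{-a.e. } s\in S.$$
   Context: $L^\alpha_+(S,\mu)$ is the set of nonnegative functions in $L^\alpha(S,\mu)$; $\stackrel{d}{=}$ between processes means equality of finite-dimensional distributions. For $\{f_t\}_{t\in T}\subset L^\alpha(S,\mu)$, the process of stable integrals $\{\int_S f_t\,dM_{\alpha,+}\}_{t\in T}$ is the S$\alpha$S (symmetric $\alpha$-stable) process $\{X_t\}$ whose finite-dimensional distributions are determined by $$\mathbb E\exp\Big\{-i\sum_{j=1}^n a_jX_{t_j}\Big\}=\exp\Big\{-\int_S\Big|\sum_{j=1}^n a_jf_{t_j}\Big|^\alpha d\mu\Big\},\quad a_j\in\mathbb R,\ t_j\in T,\ n\in\mathbb N.$$ For $\{f_t\}_{t\in T}\subset L^\alpha_+(S,\mu)$, the process of extremal integrals $\{{}^{e}\!\!\int_S f_t\,dM_{\alpha,\vee}\}_{t\in T}$, with $M_{\alpha,\vee}$ an $\alpha$-Fréchet random sup-measure with control measure $\mu$,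 is the $\alpha$-Fréchet process $\{Y_t\}$ whose finite-dimensional distributions are $$\mathbb P(Y_{t_1}\le a_1,\dots,Y_{t_n}\le a_n)=\exp\Big\{-\int_S\Big(\bigvee_{j=1}^n f_{t_j}/a_j\Big)^\alpha d\mu\Big\},\quad a_j>0,\ t_j\in T,\ n\in\mathbb N.$$ An S$\alpha$S process $\{X_t\}_{t\in T}$ and an $\alpha$-Fréchet process $\{Y_t\}_{t\in T}$ are associated if there exist a measure space $(S',\mu')$ with $\mu'$ positive and $\sigma$-finite and $\{g_t\}_{t\in T}\subset L^\alpha_+(S',\mu')$ such that $\{X_t\}\stackrel{d}{=}\{\int_{S'} g_t\,dM_{\alpha,+}\}$ and $\{Y_t\}\stackrel{d}{=}\{{}^{e}\!\!\int_{S'} g_t\,dM_{\alpha,\vee}\}$, the random (sup-)measures having control measure $\mu'$. An S$\alpha$S process is max-associable if there is an $\alpha$-Fréchet process associated with it, i.e. if it has a spectral representation by nonnegative functions. *)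

theory Defs
  imports "HOL-Probability.Probability"
begin

definition L_space :: "real \<Rightarrow> 's measure \<Rightarrow> ('s \<Rightarrow> real) set" where
  "L_space \<alpha> M = {f \<in> borel_measurable M. integrable M (\<lambda>s. \<bar>f s\<bar> powr \<alpha>)}"

definition L_space_nonneg :: "real \<Rightarrow> 's measure \<Rightarrow> ('s \<Rightarrow> real) set" where
  "L_space_nonneg \<alpha> M = {f \<in> L_space \<alpha> M. \<forall>s\<in>space M. 0 \<le> f s}"

definition real_process :: "'w measure \<Rightarrow> 't set \<Rightarrow> ('t \<Rightarrow> 'w \<Rightarrow> real) \<Rightarrow> bool" where
  "real_process P T X \<longleftrightarrow> prob_space P \<and> (\<forall>t\<in>T. X t \<in> borel_measurable P)"

text \<open>A random variable is symmetric \<open>\<alpha>\<close>-stable if its characteristic function is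
  \<open>\<theta> \<mapsto> exp (- \<sigma>\<^sup>\<alpha> \<bar>\<theta>\<bar>\<^sup>\<alpha>)\<close> for some \<open>\<sigma> \<ge> 0\<close>; a process is symmetric \<open>\<alpha>\<close>-stable if all its finite
  linear combinations are.  The scale \<open>\<sigma> = 0\<close> (a variable that vanishes almost surely) is allowed,
  as it is the law of the stable integral of \<open>0\<close>.\<close>

definition sas_rv :: "real \<Rightarrow> 'w measure \<Rightarrow> ('w \<Rightarrow> real) \<Rightarrow> bool" where
  "sas_rv \<alpha> P Z \<longleftrightarrow> (\<exists>\<sigma>\<ge>0. \<forall>\<theta>::real.
     (LINT \<omega>|P. exp (\<i> * of_real (\<theta> * Z \<omega>))) = of_real (exp (- (\<sigma> powr \<alpha> * \<bar>\<theta>\<bar> powr \<alpha>))))"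

definition sas_process :: "real \<Rightarrow> 'w measure \<Rightarrow> 't set \<Rightarrow> ('t \<Rightarrow> 'w \<Rightarrow> real) \<Rightarrow> bool" where
  "sas_process \<alpha> P T X \<longleftrightarrow> real_process P T X \<and>
     (\<forall>(n::nat) (a :: nat \<Rightarrow> real) (t :: nat \<Rightarrow> 't). (\<forall>j<n. t j \<in> T) \<longrightarrow>
        sas_rv \<alpha> P (\<lambda>\<omega>. \<Sum>j<n. a j * X (t j) \<omega>))"

text \<open>Analogously, a variable is \<open>\<alpha>\<close>-Frechet if it is nonnegative with distribution function
  \<open>x \<mapsto> exp (- \<sigma>\<^sup>\<alpha> x\<^sup>-\<^sup>\<alpha>)\<close> on \<open>x > 0\<close>, and a process is if all its finite max-linear
  combinations are.  Nonnegativity matters only for \<open>\<sigma> = 0\<close>, where it pins the law down as that of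
  the constant \<open>0\<close>.\<close>

definition frechet_rv :: "real \<Rightarrow> 'w measure \<Rightarrow> ('w \<Rightarrow> real) \<Rightarrow> bool" where
  "frechet_rv \<alpha> P Z \<longleftrightarrow> (AE \<omega> in P. 0 \<le> Z \<omega>) \<and>
     (\<exists>\<sigma>\<ge>0. \<forall>x>0. measure P {\<omega> \<in> space P. Z \<omega> \<le> x} = exp (- (\<sigma> powr \<alpha> * x powr (- \<alpha>))))"

definition frechet_process :: "real \<Rightarrow> 'w measure \<Rightarrow> 't set \<Rightarrow> ('t \<Rightarrow> 'w \<Rightarrow> real) \<Rightarrow> bool" where
  "frechet_process \<alpha> P T Y \<longleftrightarrow> real_process P T Y \<and>
     (\<forall>(n::nat) (a :: nat \<Rightarrow> real) (t :: nat \<Rightarrow> 't). 0 < n \<and> (\<forall>j<n. 0 < a j \<and> t j \<in> T) \<longrightarrow>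
        frechet_rv \<alpha> P (\<lambda>\<omega>. MAX j\<in>{..<n}. a j * Y (t j) \<omega>))"

text \<open>The processes of stable and of extremal integrals are given through their finite-dimensional
  distributions.  So \<open>eq_stable_integral \<alpha> T P X M f\<close> says that \<open>(X t)\<^sub>t\<close> equals
  \<open>(\<integral> f t dM\<^sub>\<alpha>\<^sub>,\<^sub>+)\<^sub>t\<close> in distribution, where the symmetric \<open>\<alpha>\<close>-stable random measure
  has control measure \<open>M\<close>, and \<open>eq_extremal_integral\<close> says the same for extremal integrals.\<close>

definition eq_stable_integral ::
  "real \<Rightarrow> 't set \<Rightarrow> 'w measure \<Rightarrow> ('t \<Rightarrow> 'w \<Rightarrow> real) \<Rightarrow> 's measure \<Rightarrow> ('t \<Rightarrow> 's \<Rightarrow> real) \<Rightarrow> bool" where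
  "eq_stable_integral \<alpha> T P X M f \<longleftrightarrow>
     (\<forall>(n::nat) (a :: nat \<Rightarrow> real) (t :: nat \<Rightarrow> 't). (\<forall>j<n. t j \<in> T) \<longrightarrow>
        (LINT \<omega>|P. exp (- \<i> * of_real (\<Sum>j<n. a j * X (t j) \<omega>)))
          = of_real (exp (- (LINT s|M. \<bar>\<Sum>j<n. a j * f (t j) s\<bar> powr \<alpha>))))"

definition eq_extremal_integral ::
  "real \<Rightarrow> 't set \<Rightarrow> 'w measure \<Rightarrow> ('t \<Rightarrow> 'w \<Rightarrow> real) \<Rightarrow> 's measure \<Rightarrow> ('t \<Rightarrow> 's \<Rightarrow> real) \<Rightarrow> bool" where
  "eq_extremal_integral \<alpha> T P Y M f \<longleftrightarrow>
     (\<forall>(n::nat) (a :: nat \<Rightarrow> real) (t :: nat \<Rightarrow> 't). 0 < n \<and> (\<forall>j<n. 0 < a j \<and> t j \<in> T) \<longrightarrow>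
        measure P {\<omega> \<in> space P. \<forall>j<n. Y (t j) \<omega> \<le> a j}
          = exp (- (LINT s|M. (MAX j\<in>{..<n}. f (t j) s / a j) powr \<alpha>)))"

definition associated_via ::
  "real \<Rightarrow> 't set \<Rightarrow> 'w measure \<Rightarrow> ('t \<Rightarrow> 'w \<Rightarrow> real) \<Rightarrow> 'v measure \<Rightarrow> ('t \<Rightarrow> 'v \<Rightarrow> real)
     \<Rightarrow> 's measure \<Rightarrow> ('t \<Rightarrow> 's \<Rightarrow> real) \<Rightarrow> bool" where
  "associated_via \<alpha> T P X Q Y M g \<longleftrightarrow>
     sigma_finite_measure M \<and> (\<forall>t\<in>T. g t \<in> L_space_nonneg \<alpha> M) \<and>
     eq_stable_integral \<alpha> T P X M g \<and> eq_extremal_integral \<alpha> T Q Y M g"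

text \<open>The measure space and the probability space asserted to exist below may be arbitrary, but HOL
  cannot quantify over their types.  The two types chosen here are large enough:
  \<open>associatedI\<close> and \<open>max_associableI\<close> show that a measure space and a probability space over any
  types whatsoever will do.\<close>

definition associated ::
  "real \<Rightarrow> 't set \<Rightarrow> 'w measure \<Rightarrow> ('t \<Rightarrow> 'w \<Rightarrow> real) \<Rightarrow> 'v measure \<Rightarrow> ('t \<Rightarrow> 'v \<Rightarrow> real) \<Rightarrow> bool" where
  "associated \<alpha> T P X Q Y \<longleftrightarrow> sas_process \<alpha> P T X \<and> frechet_process \<alpha> Q T Y \<and>
     (\<exists>(M :: ('t option \<Rightarrow> real) measure) g. associated_via \<alpha> T P X Q Y M g)"

definition max_associable :: "real \<Rightarrow> 't set \<Rightarrow> 'w measure \<Rightarrow> ('t \<Rightarrow> 'w \<Rightarrow> real) \<Rightarrow> bool" where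
  "max_associable \<alpha> T P X \<longleftrightarrow>
     (\<exists>(Q :: ('t \<Rightarrow> real) measure) Y. associated \<alpha> T P X Q Y)"

lemma associatedI:
  fixes T :: "'t set" and P :: "'w measure" and Q :: "'v measure" and M :: "'s measure"
    and g :: "'t \<Rightarrow> 's \<Rightarrow> real"
  assumes "sas_process \<alpha> P T X" "frechet_process \<alpha> Q T Y" and via: "associated_via \<alpha> T P X Q Y M g"
  shows "associated \<alpha> T P X Q Y"
proof -
  interpret sigma_finite_measure M using via by (simp add: associated_via_def)
  have g: "g t \<in> borel_measurable M" "integrable M (\<lambda>s. \<bar>g t s\<bar> powr \<alpha>)"
    "\<And>s. s \<in> space M \<Longrightarrow> 0 \<le> g t s" if "t \<in> T" for t
    using via that by (auto simp: associated_via_def L_space_def L_space_nonneg_def)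
  obtain A :: "nat \<Rightarrow> 's set" where A: "range A \<subseteq> sets M" "(\<Union>i. A i) = space M"
    "\<And>i. emeasure M (A i) \<noteq> \<infinity>" "incseq A"
    using sigma_finite_incseq by metis
  define h where "h s = real (LEAST i. s \<in> A i)" for s
  have [measurable]: "\<And>i. A i \<in> sets M" using A(1) by auto
  have [measurable]: "h \<in> borel_measurable M"
    unfolding h_def by measurable
  define I where "I = insert None (Some ` T)"
  define \<phi> where "\<phi> s = (\<lambda>i\<in>I. case i of None \<Rightarrow> h s | Some t \<Rightarrow> g t s)" for s
  define N where "N = PiM I (\<lambda>_. borel :: real measure)"
  have [measurable]: "\<phi> \<in> measurable M N"
    unfolding \<phi>_def N_def
    by (rule measurable_restrict) (auto simp: I_def g)
  define M' where "M' = distr M N \<phi>"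
  define g' where "g' t x = max 0 (x (Some t))" for t and x :: "'t option \<Rightarrow> real"
  have m_None [measurable]: "(\<lambda>x. x None) \<in> borel_measurable N"
    unfolding N_def by (rule measurable_component_singleton) (simp add: I_def)
  have g'N [measurable]: "g' t \<in> borel_measurable N" if "t \<in> T" for t
  proof -
    have [measurable]: "(\<lambda>x. x (Some t)) \<in> borel_measurable N"
      unfolding N_def by (rule measurable_component_singleton) (use that in \<open>simp add: I_def\<close>)
    show ?thesis unfolding g'_def by measurable
  qed
  have g'\<phi>: "g' t (\<phi> s) = g t s" if "t \<in> T" "s \<in> space M" for t s
    using that g(3)[OF that] by (simp add: g'_def \<phi>_def I_def)
  have h\<phi>: "\<phi> s None = h s" for s by (simp add: \<phi>_def I_def)
  have sf: "sigma_finite_measure M'"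
  proof
    define B where "B i = {x \<in> space N. x None \<le> real i}" for i :: nat
    have BN [measurable]: "B i \<in> sets N" for i unfolding B_def by measurable
    have "\<Union> (range B) = space M'"
      by (auto simp: B_def M'_def real_arch_simple)
    moreover have "emeasure M' (B i) \<noteq> \<infinity>" for i
    proof -
      have "\<phi> -` B i \<inter> space M \<subseteq> A i"
      proof
        fix s assume s: "s \<in> \<phi> -` B i \<inter> space M"
        then obtain k where "s \<in> A k" using A(2) by blast
        then have "s \<in> A (LEAST i. s \<in> A i)" by (rule LeastI)
        moreover have "(LEAST i. s \<in> A i) \<le> i" using s by (simp add: B_def h\<phi> h_def)
        ultimately show "s \<in> A i" using A(4) by (auto simp: incseq_def)
      qed
      then have "emeasure M (\<phi> -` B i \<inter> space M) \<le> emeasure M (A i)"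
        by (rule emeasure_mono) simp
      then show ?thesis using A(3)[of i]
        by (simp add: M'_def emeasure_distr top.extremum_unique) (metis neq_top_trans)
    qed
    moreover have "range B \<subseteq> sets M'" using BN by (auto simp: M'_def)
    ultimately show "\<exists>C. countable C \<and> C \<subseteq> sets M' \<and> \<Union> C = space M' \<and> (\<forall>a\<in>C. emeasure M' a \<noteq> \<infinity>)"
      by (intro exI[of _ "range B"]) auto
  qed
  have "g' t \<in> L_space_nonneg \<alpha> M'" if t: "t \<in> T" for t
  proof -
    have [measurable]: "g' t \<in> borel_measurable N" using g'N t by simp
    have "integrable M (\<lambda>s. \<bar>g' t (\<phi> s)\<bar> powr \<alpha>)"
      using g(2)[OF t] by (simp add: g'\<phi> t cong: Bochner_Integration.integrable_cong)
    then have "integrable M' (\<lambda>x. \<bar>g' t x\<bar> powr \<alpha>)"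
      unfolding M'_def by (subst integrable_distr_eq) auto
    then show ?thesis by (auto simp: L_space_nonneg_def L_space_def M'_def g'N[OF t]) (simp add: g'_def)
  qed
  moreover have "eq_stable_integral \<alpha> T P X M' g'"
  proof -
    have "(LINT s|M'. \<bar>\<Sum>j<n. a j * g' (t j) s\<bar> powr \<alpha>) = (LINT s|M. \<bar>\<Sum>j<n. a j * g (t j) s\<bar> powr \<alpha>)"
      if t: "\<forall>j<n. t j \<in> T" for n :: nat and a t
    proof -
      have [measurable]: "(\<lambda>x. \<bar>\<Sum>j<n. a j * g' (t j) x\<bar> powr \<alpha>) \<in> borel_measurable N"
        using t by (intro powr_real_measurable borel_measurable_const borel_measurable_abs borel_measurable_sum
            borel_measurable_times g'N) auto
      show ?thesis unfolding M'_def
        by (subst integral_distr) (auto intro!: Bochner_Integration.integral_cong sum.cong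
            arg_cong[where f = "\<lambda>x. \<bar>x\<bar> powr \<alpha>"] simp: g'\<phi> t)
    qed
    then show ?thesis using via by (simp add: associated_via_def eq_stable_integral_def)
  qed
  moreover have "eq_extremal_integral \<alpha> T Q Y M' g'"
  proof -
    have "(LINT s|M'. (MAX j\<in>{..<n}. g' (t j) s / a j) powr \<alpha>)
        = (LINT s|M. (MAX j\<in>{..<n}. g (t j) s / a j) powr \<alpha>)"
      if t: "0 < n" "\<forall>j<n. 0 < a j \<and> t j \<in> T" for n :: nat and a t
    proof -
      have [measurable]: "(\<lambda>x. (MAX j\<in>{..<n}. g' (t j) x / a j) powr \<alpha>) \<in> borel_measurable N"
        using t by (intro powr_real_measurable borel_measurable_const borel_measurable_Max
            borel_measurable_divide g'N) auto
      show ?thesis unfolding M'_def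
        by (subst integral_distr) (auto intro!: Bochner_Integration.integral_cong
            arg_cong[where f = "\<lambda>x. Max x powr \<alpha>"] image_cong simp: g'\<phi> t)
    qed
    then show ?thesis using via by (simp add: associated_via_def eq_extremal_integral_def)
  qed
  ultimately have "associated_via \<alpha> T P X Q Y M' g'"
    using sf via by (simp add: associated_via_def)
  then show ?thesis using assms unfolding associated_def by blast
qed

lemma max_associableI:
  fixes T :: "'t set" and P :: "'w measure" and Q :: "'v measure"
  assumes "associated \<alpha> T P X Q Y"
  shows "max_associable \<alpha> T P X"
proof -
  have sas: "sas_process \<alpha> P T X" and fr: "frechet_process \<alpha> Q T Y"
    using assms by (auto simp: associated_def)
  obtain M :: "('t option \<Rightarrow> real) measure" and g where via: "associated_via \<alpha> T P X Q Y M g"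
    using assms by (auto simp: associated_def)
  interpret prob_space Q using fr by (simp add: frechet_process_def real_process_def)
  have Y: "Y t \<in> borel_measurable Q" if "t \<in> T" for t
    using fr that by (simp add: frechet_process_def real_process_def)
  define N where "N = PiM T (\<lambda>_. borel :: real measure)"
  define \<phi> where "\<phi> \<omega> = (\<lambda>t\<in>T. Y t \<omega>)" for \<omega>
  have \<phi> [measurable]: "\<phi> \<in> measurable Q N"
    unfolding \<phi>_def N_def by (rule measurable_restrict) (simp add: Y)
  define Q' where "Q' = distr Q N \<phi>"
  define Z where "Z t \<omega> = \<omega> t" for t :: 't and \<omega> :: "'t \<Rightarrow> real"
  have ZN: "Z t \<in> borel_measurable N" if "t \<in> T" for t
    unfolding Z_def N_def using that by (rule measurable_component_singleton)
  have Z\<phi>: "Z t (\<phi> \<omega>) = Y t \<omega>" if "t \<in> T" for t \<omega>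
    using that by (simp add: Z_def \<phi>_def)
  have rp: "real_process Q' T Z"
    using ZN by (auto simp: real_process_def Q'_def prob_space_distr)
  have transfer: "measure Q' {\<omega> \<in> space Q'. S \<omega>} = measure Q {\<omega> \<in> space Q. S (\<phi> \<omega>)}"
    if "{\<omega> \<in> space N. S \<omega>} \<in> sets N" for S
  proof -
    have "\<phi> -` {\<omega> \<in> space N. S \<omega>} \<inter> space Q = {\<omega> \<in> space Q. S (\<phi> \<omega>)}"
      using measurable_space[OF \<phi>] by auto
    then show ?thesis using that by (simp add: Q'_def measure_distr)
  qed
  have "frechet_rv \<alpha> Q' (\<lambda>\<omega>. MAX j\<in>{..<n}. a j * Z (t j) \<omega>)"
    if t: "0 < n" "\<forall>j<n. 0 < a j \<and> t j \<in> T" for n :: nat and a t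
  proof -
    have m [measurable]: "(\<lambda>\<omega>. MAX j\<in>{..<n}. a j * Z (t j) \<omega>) \<in> borel_measurable N"
      using t by (intro borel_measurable_Max borel_measurable_times ZN) auto
    have eq: "(MAX j\<in>{..<n}. a j * Z (t j) (\<phi> \<omega>)) = (MAX j\<in>{..<n}. a j * Y (t j) \<omega>)" for \<omega>
      using t by (intro arg_cong[where f = Max] image_cong) (auto simp: Z\<phi>)
    have "frechet_rv \<alpha> Q (\<lambda>\<omega>. MAX j\<in>{..<n}. a j * Y (t j) \<omega>)"
      using fr t by (auto simp: frechet_process_def)
    moreover have "(AE \<omega> in Q'. 0 \<le> (MAX j\<in>{..<n}. a j * Z (t j) \<omega>)) \<longleftrightarrow>
        (AE \<omega> in Q. 0 \<le> (MAX j\<in>{..<n}. a j * Y (t j) \<omega>))"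
      unfolding Q'_def by (subst AE_distr_iff) (measurable, simp add: eq)
    moreover have "measure Q' {\<omega> \<in> space Q'. (MAX j\<in>{..<n}. a j * Z (t j) \<omega>) \<le> x}
       = measure Q {\<omega> \<in> space Q. (MAX j\<in>{..<n}. a j * Y (t j) \<omega>) \<le> x}" for x
      by (subst transfer) (measurable, simp only: eq)
    ultimately show ?thesis by (simp add: frechet_rv_def)
  qed
  then have fr': "frechet_process \<alpha> Q' T Z"
    using rp by (simp add: frechet_process_def)
  have "measure Q' {\<omega> \<in> space Q'. \<forall>j<n. Z (t j) \<omega> \<le> a j}
      = measure Q {\<omega> \<in> space Q. \<forall>j<n. Y (t j) \<omega> \<le> a j}"
    if t: "\<forall>j<n. 0 < a j \<and> t j \<in> T" for n :: nat and a t
  proof -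
    have "{\<omega> \<in> space N. \<forall>j\<in>{..<n}. Z (t j) \<omega> \<le> a j} \<in> sets N"
      using t by (intro sets.sets_Collect_finite_All' borel_measurable_le ZN
          sets.sets_Collect_finite_All) auto
    then have m: "{\<omega> \<in> space N. \<forall>j<n. Z (t j) \<omega> \<le> a j} \<in> sets N"
      by (simp only: Ball_def lessThan_iff)
    have "(\<forall>j<n. Z (t j) (\<phi> \<omega>) \<le> a j) \<longleftrightarrow> (\<forall>j<n. Y (t j) \<omega> \<le> a j)" for \<omega>
      using t by (auto simp: Z\<phi>)
    then show ?thesis using transfer[OF m] by simp
  qed
  then have "associated_via \<alpha> T P X Q' Z M g"
    using via by (simp add: associated_via_def eq_extremal_integral_def)
  then show ?thesis
    using sas fr' unfolding max_associable_def associated_def by blast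
qed

end

theory Submission
  imports Defs
begin

text \<open>
  Suppose first that \<open>X\<close> also has a nonnegative representation \<open>(g\<^sub>t)\<close>.  The law of \<open>X\<close> determines the
  norms \<open>\<integral> \<bar>a f\<^sub>1 + b f\<^sub>2\<bar>\<^sup>\<alpha>\<close>, so these agree with the norms of \<open>a g\<^sub>1 + b g\<^sub>2\<close>, and the task is to read the
  sign of \<open>f\<^sub>1 f\<^sub>2\<close> off these norms.  For real numbers \<open>x\<close> and \<open>y\<close> put
  \<open>D\<^sub>r(x, y) = \<bar>e\<^sup>r\<^sup>/\<^sup>2 x\<bar>\<^sup>\<alpha> + \<bar>e\<^sup>-\<^sup>r\<^sup>/\<^sup>2 y\<bar>\<^sup>\<alpha> - \<bar>e\<^sup>r\<^sup>/\<^sup>2 x + e\<^sup>-\<^sup>r\<^sup>/\<^sup>2 y\<bar>\<^sup>\<alpha>\<close>.  A Mellin-type computation shows that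
  the integral of \<open>D\<^sub>r(x, y)\<close> over all real \<open>r\<close> is \<open>\<bar>x y\<bar>\<^sup>\<alpha>\<^sup>/\<^sup>2\<close> times a constant that is \<open>p\<close> if \<open>x y > 0\<close>
  and \<open>q\<close> if \<open>x y < 0\<close> (\<open>integral_cross_defect\<close>).  For \<open>0 < \<alpha> < 2\<close> one has \<open>\<bar>p\<bar> < q\<close> (\<open>sign_weight_less\<close>), by
  a strict Clarkson inequality.  Integrating \<open>D\<^sub>r(f\<^sub>1, \<plusminus>f\<^sub>2)\<close> over \<open>r\<close> and over the space, in both orders, gives
  two linear equations for the masses of \<open>\<bar>f\<^sub>1 f\<^sub>2\<bar>\<^sup>\<alpha>\<^sup>/\<^sup>2\<close> on \<open>f\<^sub>1 f\<^sub>2 > 0\<close> and on \<open>f\<^sub>1 f\<^sub>2 < 0\<close>, with right-hand sides in which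
  only the former kind of mass of \<open>g\<^sub>1, g\<^sub>2\<close> occurs; solving them shows that the second mass vanishes
  (\<open>AE_mult_nonneg_of_equal_norms\<close>).

  Conversely, if \<open>f\<^sub>1 f\<^sub>2 \<ge> 0\<close> almost everywhere for any two of the functions, then almost everywhere any
  finitely many of them share one sign, so \<open>\<bar>\<Sum>\<^sub>j a\<^sub>j f\<^sub>j\<bar> = \<bar>\<Sum>\<^sub>j a\<^sub>j \<bar>f\<^sub>j\<bar>\<bar>\<close> and \<open>(\<bar>f\<^sub>t\<bar>)\<close> represents \<open>X\<close>
  as well (\<open>eq_stable_integral_abs\<close>).  It remains to realise the extremal integrals of
  nonnegative functions \<open>g\<^sub>t\<close> on a probability space (\<open>extremal_process_exists\<close>).  All of them are obtained at once,
  whatever the index set, as suprema of \<open>c\<^sup>-\<^sup>1\<^sup>/\<^sup>\<alpha> g\<^sub>t(s)\<close> over the points \<open>(s, c)\<close>, \<open>c > 0\<close>, of a single Poisson process, whose void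
  probabilities \<open>e\<^sup>-\<^sup>\<mu>\<^sup>(\<^sup>B\<^sup>)\<close> (\<open>poisson_process_exists\<close>) are exactly the distribution functions required.
\<close>

section \<open>Reading signs off the norms of linear combinations\<close>

text \<open>The amount by which \<open>\<bar>\<cdot>\<bar>\<^sup>\<alpha>\<close> fails to be additive at the pair of summands
  \<open>(e\<^sup>r\<^sup>/\<^sup>2 x, e\<^sup>-\<^sup>r\<^sup>/\<^sup>2 y)\<close>.  The exponential weights are chosen so that multiplying \<open>x\<close> and \<open>y\<close> by
  positive constants amounts to a factor and a translation of \<open>r\<close>; integration over
  \<open>r\<close> then depends on \<open>x\<close> and \<open>y\<close> only through \<open>\<bar>x y\<bar>\<^sup>\<alpha>\<^sup>/\<^sup>2\<close> and the sign of \<open>x y\<close>.\<close>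

definition cross_defect :: "real \<Rightarrow> real \<Rightarrow> real \<Rightarrow> real \<Rightarrow> real" where
  "cross_defect \<alpha> r x y = exp (\<alpha> * r / 2) * \<bar>x\<bar> powr \<alpha> + exp (- (\<alpha> * r / 2)) * \<bar>y\<bar> powr \<alpha>
     - \<bar>exp (r / 2) * x + exp (- (r / 2)) * y\<bar> powr \<alpha>"

lemma exp_half_powr: "(exp (r / 2) :: real) powr \<alpha> = exp (\<alpha> * r / 2)"
  "(exp (- (r / 2)) :: real) powr \<alpha> = exp (- (\<alpha> * r / 2))"
  by (simp_all add: exp_powr_real mult.commute)

lemma borel_measurable_cross_defect [measurable (raw)]:
  assumes "r \<in> borel_measurable M" "x \<in> borel_measurable M" "y \<in> borel_measurable M"
  shows "(\<lambda>s. cross_defect \<alpha> (r s) (x s) (y s)) \<in> borel_measurable M"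
  using assms unfolding cross_defect_def by measurable

lemma cross_defect_eq_0:
  assumes "x * y = 0"
  shows "cross_defect \<alpha> r x y = 0"
  using assms by (auto simp: cross_defect_def abs_mult powr_mult exp_half_powr)

text \<open>Writing \<open>\<bar>x\<bar> = e\<^sup>p\<close> and \<open>\<bar>y\<bar> = e\<^sup>q\<close>, the factor \<open>e\<^sup>(\<^sup>p\<^sup>+\<^sup>q\<^sup>)\<^sup>/\<^sup>2\<close> can be pulled out of both
  \<open>e\<^sup>r\<^sup>/\<^sup>2 x\<close> and \<open>e\<^sup>-\<^sup>r\<^sup>/\<^sup>2 y\<close>, and \<open>r + p - q\<close> remains in place of \<open>r\<close>.\<close>

lemma cross_defect_scale:
  assumes "x * y \<noteq> 0"
  shows "cross_defect \<alpha> r x y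
    = \<bar>x * y\<bar> powr (\<alpha> / 2) * cross_defect \<alpha> (r + (ln \<bar>x\<bar> - ln \<bar>y\<bar>)) 1 (sgn (x * y))"
proof -
  define p q where "p = ln \<bar>x\<bar>" and "q = ln \<bar>y\<bar>"
  have x: "\<bar>x\<bar> = exp p" and y: "\<bar>y\<bar> = exp q" using assms by (auto simp: p_def q_def)
  let ?u = "r + (p - q)"
  have "\<bar>exp (r / 2) * x + exp (- (r / 2)) * y\<bar>
      = \<bar>sgn x * (exp (r / 2) * x + exp (- (r / 2)) * y)\<bar>"
    using assms by (simp add: abs_mult abs_sgn_eq)
  also have "sgn x * (exp (r / 2) * x + exp (- (r / 2)) * y)
      = exp (r / 2) * \<bar>x\<bar> + exp (- (r / 2)) * (sgn (x * y) * \<bar>y\<bar>)"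
    using assms by (cases "0 < x"; cases "0 < y") (auto simp: sgn_mult algebra_simps not_less order.order_iff_strict)
  also have "\<dots> = exp ((p + q) / 2) * (exp (?u / 2) * 1 + exp (- (?u / 2)) * sgn (x * y))"
  proof -
    have "exp (r / 2) * exp p = exp ((p + q) / 2) * exp (?u / 2)"
      "exp (- (r / 2)) * exp q = exp ((p + q) / 2) * exp (- (?u / 2))"
      unfolding exp_add[symmetric] by (rule arg_cong[of _ _ exp], simp add: field_simps)+
    then show ?thesis by (simp add: x y distrib_left mult.left_commute mult.commute)
  qed
  finally have sum: "\<bar>exp (r / 2) * x + exp (- (r / 2)) * y\<bar> powr \<alpha>
      = exp (\<alpha> * (p + q) / 2) * \<bar>exp (?u / 2) * 1 + exp (- (?u / 2)) * sgn (x * y)\<bar> powr \<alpha>"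
    by (simp add: abs_mult powr_mult exp_powr_real mult.commute)
  have "\<bar>x * y\<bar> powr (\<alpha> / 2) = exp (\<alpha> * (p + q) / 2)"
    by (simp add: abs_mult x y exp_add[symmetric] exp_powr_real mult.commute)
  moreover have "exp (\<alpha> * r / 2) * \<bar>x\<bar> powr \<alpha> = exp (\<alpha> * (p + q) / 2) * exp (\<alpha> * ?u / 2)"
    "exp (- (\<alpha> * r / 2)) * \<bar>y\<bar> powr \<alpha> = exp (\<alpha> * (p + q) / 2) * exp (- (\<alpha> * ?u / 2))"
    unfolding x y exp_powr_real exp_add[symmetric]
    by (rule arg_cong[of _ _ exp], simp add: field_simps)+
  moreover have "\<bar>sgn (x * y)\<bar> = 1" using assms by (simp add: abs_sgn_eq)
  ultimately show ?thesis
    unfolding cross_defect_def sum p_def[symmetric] q_def[symmetric]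
    by (simp add: algebra_simps)
qed

lemma cross_defect_uminus:
  assumes "\<bar>e\<bar> = 1"
  shows "cross_defect \<alpha> (- u) 1 e = cross_defect \<alpha> u 1 e"
proof -
  have "e = 1 \<or> e = - 1" using assms by auto
  then show ?thesis
    by (auto simp: cross_defect_def add.commute abs_minus_commute)
qed

text \<open>By symmetry only \<open>u \<ge> 0\<close> matters.  With \<open>z = e\<^sup>-\<^sup>u \<le> 1\<close> the defect is
  \<open>e\<^sup>\<alpha>\<^sup>u\<^sup>/\<^sup>2 (1 - (1 \<plusminus> z)\<^sup>\<alpha>) + e\<^sup>-\<^sup>\<alpha>\<^sup>u\<^sup>/\<^sup>2\<close>, and as \<open>0 < \<alpha> < 2\<close> the power \<open>w\<^sup>\<alpha>\<close> of \<open>w = 1 \<plusminus> z\<close> lies between \<open>1\<close> and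
  \<open>w\<^sup>2\<close>, so that \<open>\<bar>1 - w\<^sup>\<alpha>\<bar> \<le> 3 z\<close>.  The exponent \<open>\<alpha> / 2 - 1\<close> that results is negative because
  \<open>\<alpha> < 2\<close>.\<close>

lemma cross_defect_bound:
  assumes \<alpha>: "0 < \<alpha>" "\<alpha> < 2" and e: "\<bar>e\<bar> = 1"
  shows "\<bar>cross_defect \<alpha> u 1 e\<bar> \<le> 3 * exp (- (1 - \<alpha> / 2) * \<bar>u\<bar>) + exp (- (\<alpha> / 2) * \<bar>u\<bar>)"
proof -
  have *: "\<bar>cross_defect \<alpha> u 1 e\<bar> \<le> 3 * exp (- (1 - \<alpha> / 2) * u) + exp (- (\<alpha> / 2) * u)"
    if u: "0 \<le> u" for u
  proof -
    define z where "z = exp (- u)"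
    define w where "w = 1 + e * z"
    have z: "0 < z" "z \<le> 1" using u by (auto simp: z_def)
    have e': "e = 1 \<or> e = - 1" using e by auto
    have w: "0 \<le> w" using e' z by (auto simp: w_def)
    have zz: "z * z \<le> z" using z by (simp add: mult_left_le)
    have "\<bar>1 - w powr \<alpha>\<bar> \<le> 3 * z"
    proof (cases "e = 1")
      case True
      then have "1 \<le> w" using z by (simp add: w_def)
      then have "1 \<le> w powr \<alpha>" "w powr \<alpha> \<le> w powr 2"
        using \<alpha> by (auto intro: ge_one_powr_ge_zero powr_mono simp del: powr_numeral)
      moreover have "w powr 2 = w * w" using w by (simp add: powr_numeral power2_eq_square)
      moreover have "w * w = 1 + 2 * z + z * z" using True by (simp add: w_def algebra_simps)
      ultimately show ?thesis using z zz by (intro abs_leI) linarith+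
    next
      case False
      then have "w \<le> 1" using e' z by (auto simp: w_def)
      then have "w powr \<alpha> \<le> 1" "w powr 2 \<le> w powr \<alpha>"
        using \<alpha> w powr_mono'[of \<alpha> 2 w] powr_mono2[of \<alpha> w 1] by auto
      moreover have "w powr 2 = w * w" using w by (simp add: powr_numeral power2_eq_square)
      moreover have "w * w = 1 - 2 * z + z * z" using False e' by (auto simp: w_def algebra_simps)
      moreover have "0 < z * z" using z by simp
      ultimately show ?thesis using z by (intro abs_leI) linarith+
    qed
    then have "exp (\<alpha> * u / 2) * \<bar>1 - w powr \<alpha>\<bar> \<le> exp (\<alpha> * u / 2) * (3 * z)" by simp
    also have "\<dots> = 3 * exp (- (1 - \<alpha> / 2) * u)"
      by (simp add: z_def exp_add[symmetric] algebra_simps)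
    finally have 1: "exp (\<alpha> * u / 2) * \<bar>1 - w powr \<alpha>\<bar> \<le> 3 * exp (- (1 - \<alpha> / 2) * u)" .
    have "exp (u / 2) * 1 + exp (- (u / 2)) * e = exp (u / 2) * w"
      by (simp add: w_def z_def distrib_left exp_add[symmetric] mult.left_commute mult.commute[of e])
    then have "\<bar>exp (u / 2) * 1 + exp (- (u / 2)) * e\<bar> powr \<alpha> = exp (\<alpha> * u / 2) * w powr \<alpha>"
      using w by (simp add: abs_mult powr_mult exp_half_powr)
    then have "cross_defect \<alpha> u 1 e = exp (\<alpha> * u / 2) * (1 - w powr \<alpha>) + exp (- (\<alpha> / 2) * u)"
      using e by (simp add: cross_defect_def algebra_simps)
    then have "\<bar>cross_defect \<alpha> u 1 e\<bar>
        \<le> \<bar>exp (\<alpha> * u / 2) * (1 - w powr \<alpha>)\<bar> + \<bar>exp (- (\<alpha> / 2) * u)\<bar>"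
      by (simp only: abs_triangle_ineq)
    then show ?thesis using 1 by (simp add: abs_mult)
  qed
  show ?thesis
    using *[of u] *[of "- u"] cross_defect_uminus[OF e, of \<alpha> u] by (cases "0 \<le> u") auto
qed

lemma integrable_exp_minus_abs:
  assumes "0 < (c::real)"
  shows "integrable lborel (\<lambda>u::real. exp (- c * \<bar>u\<bar>))"
proof -
  let ?h = "\<lambda>u::real. indicator {0<..} u * exp (- (u * c))"
  have h: "integrable lborel ?h"
    using integrable_I0i_exp_mscale[OF assms] by (simp add: set_integrable_def)
  have "integrable lborel (\<lambda>u. ?h (0 + (-1) * u))"
    by (rule lborel_integrable_real_affine[OF h]) simp
  then have "integrable lborel (\<lambda>u. ?h u + ?h (- u))"
    using h by (intro Bochner_Integration.integrable_add) auto
  then show ?thesis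
  proof (rule Bochner_Integration.integrable_bound)
    show "AE u in lborel. norm (exp (- c * \<bar>u\<bar>)) \<le> norm (?h u + ?h (- u))"
      using AE_lborel_singleton[of 0] by eventually_elim (auto simp: indicator_def mult.commute)
  qed simp
qed

lemma integrable_cross_defect:
  assumes "0 < \<alpha>" "\<alpha> < 2" "\<bar>e\<bar> = 1"
  shows "integrable lborel (\<lambda>u. cross_defect \<alpha> u 1 e)"
proof (rule Bochner_Integration.integrable_bound)
  show "integrable lborel (\<lambda>u. 3 * exp (- (1 - \<alpha> / 2) * \<bar>u\<bar>) + exp (- (\<alpha> / 2) * \<bar>u\<bar>))"
    using assms by (intro Bochner_Integration.integrable_add integrable_mult_right integrable_exp_minus_abs) auto
  show "AE u in lborel. norm (cross_defect \<alpha> u 1 e)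
      \<le> norm (3 * exp (- (1 - \<alpha> / 2) * \<bar>u\<bar>) + exp (- (\<alpha> / 2) * \<bar>u\<bar>))"
    unfolding real_norm_def by (intro AE_I2 order_trans[OF cross_defect_bound[OF assms] abs_ge_self])
qed simp

definition sign_weight :: "real \<Rightarrow> real \<Rightarrow> real" where
  "sign_weight \<alpha> e = (LINT u|lborel. cross_defect \<alpha> u 1 e)"

lemma powr_add_less:
  assumes "0 < p" "p < 1" "0 < x" "0 < (y::real)"
  shows "(x + y) powr p < x powr p + y powr p"
proof -
  have "(x + y) powr p = (x + y) * (x + y) powr (p - 1)"
    using assms by (simp add: powr_mult_base)
  also have "\<dots> = x * (x + y) powr (p - 1) + y * (x + y) powr (p - 1)" by (simp add: algebra_simps)
  also have "\<dots> < x * x powr (p - 1) + y * y powr (p - 1)"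
    using assms by (intro add_strict_mono mult_strict_left_mono powr_less_mono2_neg) auto
  finally show ?thesis using assms by (simp add: powr_mult_base)
qed

text \<open>The parallelogram law \<open>(a + b)\<^sup>2 + (a - b)\<^sup>2 = 2 (a\<^sup>2 + b\<^sup>2)\<close>, raised to the power \<open>p = \<alpha> / 2 < 1\<close>:
  \<open>x \<mapsto> x\<^sup>p\<close> is concave, which bounds the mean of the two powers on the left, and strictly
  subadditive, which splits \<open>(a\<^sup>2 + b\<^sup>2)\<^sup>p\<close>.\<close>

lemma powr_clarkson_strict:
  assumes \<alpha>: "0 < \<alpha>" "\<alpha> < 2" and "0 < a" "0 < (b::real)"
  shows "\<bar>a + b\<bar> powr \<alpha> + \<bar>a - b\<bar> powr \<alpha> < 2 * (a powr \<alpha> + b powr \<alpha>)"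
proof -
  have sq: "\<bar>x\<bar> powr \<alpha> = (x\<^sup>2) powr (\<alpha> / 2)" for x :: real
    by (subst power2_abs[symmetric], subst powr_numeral[symmetric], simp, subst powr_powr) simp
  \<comment> \<open>Midpoint concavity, by adding up two weighted arithmetic-geometric mean inequalities against
    the mean \<open>c\<close>.\<close>
  have mid: "(x powr (\<alpha> / 2) + y powr (\<alpha> / 2)) / 2 \<le> ((x + y) / 2) powr (\<alpha> / 2)"
    if "0 \<le> x" "0 \<le> y" for x y :: real
  proof (cases "x + y = 0")
    case True
    then have "x = 0" "y = 0" using that by auto
    then show ?thesis by simp
  next
    case False
    define c where "c = (x + y) / 2"
    have c: "0 < c" using False that by (simp add: c_def)
    have young: "z powr (\<alpha> / 2) * c powr (1 - \<alpha> / 2) \<le> \<alpha> / 2 * z + (1 - \<alpha> / 2) * c" if "0 \<le> z" for z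
      using Youngs_inequality_0[of "\<alpha> / 2" "1 - \<alpha> / 2" z c] \<alpha> c that by (cases "z = 0") auto
    have "x powr (\<alpha> / 2) * c powr (1 - \<alpha> / 2) \<le> \<alpha> / 2 * x + (1 - \<alpha> / 2) * c"
      "y powr (\<alpha> / 2) * c powr (1 - \<alpha> / 2) \<le> \<alpha> / 2 * y + (1 - \<alpha> / 2) * c"
      using young that by blast+
    moreover have "\<alpha> / 2 * x + (1 - \<alpha> / 2) * c + (\<alpha> / 2 * y + (1 - \<alpha> / 2) * c) = 2 * c"
      by (simp add: c_def field_simps)
    ultimately have "(x powr (\<alpha> / 2) + y powr (\<alpha> / 2)) * c powr (1 - \<alpha> / 2) \<le> 2 * c"
      unfolding distrib_right by linarith
    also have "2 * c = 2 * c powr (\<alpha> / 2) * c powr (1 - \<alpha> / 2)"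
      using c by (simp add: powr_add[symmetric])
    finally show ?thesis using c by (simp add: c_def[symmetric])
  qed
  have "\<bar>a + b\<bar> powr \<alpha> + \<bar>a - b\<bar> powr \<alpha> \<le> 2 * (((a + b)\<^sup>2 + (a - b)\<^sup>2) / 2) powr (\<alpha> / 2)"
    using mid[of "(a + b)\<^sup>2" "(a - b)\<^sup>2"] by (simp add: sq)
  also have "((a + b)\<^sup>2 + (a - b)\<^sup>2) / 2 = a\<^sup>2 + b\<^sup>2" by (simp add: power2_eq_square algebra_simps)
  also have "(a\<^sup>2 + b\<^sup>2) powr (\<alpha> / 2) < (a\<^sup>2) powr (\<alpha> / 2) + (b\<^sup>2) powr (\<alpha> / 2)"
    using assms by (intro powr_add_less) auto
  finally show ?thesis using assms by (simp add: sq[symmetric])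
qed

lemma integral_lborel_strict_mono:
  fixes f g :: "real \<Rightarrow> real"
  assumes i: "integrable lborel f" "integrable lborel g" and less: "\<And>x. f x < g x"
  shows "(LINT x|lborel. f x) < (LINT x|lborel. g x)"
proof -
  have d: "integrable lborel (\<lambda>x. g x - f x)" using i by simp
  have "(LINT x|lborel. g x - f x) \<noteq> 0"
  proof
    assume "(LINT x|lborel. g x - f x) = 0"
    then have "AE x in lborel. g x - f x = 0"
      using integral_nonneg_eq_0_iff_AE[OF d] less by (simp add: less_imp_le)
    moreover have "(g x - f x = 0) = False" for x using less[of x] by simp
    ultimately have "AE x in (lborel :: real measure). False" by simp
    then have "emeasure (lborel :: real measure) UNIV = 0" by (simp add: AE_iff_measurable[of UNIV])
    then show False by simp
  qed
  moreover have "0 \<le> (LINT x|lborel. g x - f x)"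
    using less by (intro Bochner_Integration.integral_nonneg) (simp add: less_imp_le)
  ultimately show ?thesis using i by simp
qed

text \<open>The integrated defects of a pair of equal and of a pair of opposite signs differ, even in absolute
  value; this is what makes the sign of \<open>x y\<close> visible.  Both strict inequalities
  hold pointwise: \<open>\<bar>a - b\<bar> < a + b\<close> for the difference of the two defects, and
  the strict Clarkson inequality for their sum.  The latter turns into an equality at \<open>\<alpha> = 2\<close>, where indeed
  the norms of linear combinations of \<open>f\<close> and \<open>g\<close> determine \<open>\<integral> f g\<close> but not the sign of \<open>f g\<close>.\<close>

lemma sign_weight_less:
  assumes \<alpha>: "0 < \<alpha>" "\<alpha> < 2"
  shows "\<bar>sign_weight \<alpha> 1\<bar> < sign_weight \<alpha> (- 1)"
proof -
  have i: "integrable lborel (\<lambda>u. cross_defect \<alpha> u 1 1)" "integrable lborel (\<lambda>u. cross_defect \<alpha> u 1 (- 1))"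
    using \<alpha> by (auto intro: integrable_cross_defect)
  have "cross_defect \<alpha> u 1 1 < cross_defect \<alpha> u 1 (- 1)" for u
  proof -
    have "\<bar>exp (u / 2) - exp (- (u / 2))\<bar> < exp (u / 2) + exp (- (u / 2))"
      by (simp add: abs_if)
    then show ?thesis using \<alpha> by (simp add: cross_defect_def powr_less_mono2)
  qed
  then have "sign_weight \<alpha> 1 < sign_weight \<alpha> (- 1)"
    unfolding sign_weight_def by (intro integral_lborel_strict_mono i)
  moreover
  have "- cross_defect \<alpha> u 1 1 < cross_defect \<alpha> u 1 (- 1)" for u
    using powr_clarkson_strict[OF \<alpha>, of "exp (u / 2)" "exp (- (u / 2))"]
    by (simp add: cross_defect_def exp_half_powr)
  then have "(LINT u|lborel. - cross_defect \<alpha> u 1 1) < sign_weight \<alpha> (- 1)"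
    unfolding sign_weight_def by (intro integral_lborel_strict_mono i Bochner_Integration.integrable_minus)
  ultimately show ?thesis by (simp add: sign_weight_def abs_less_iff)
qed

lemma
  assumes \<alpha>: "0 < \<alpha>" "\<alpha> < 2"
  shows integrable_cross_defect_scaled: "integrable lborel (\<lambda>r. cross_defect \<alpha> r x y)" (is ?A)
    and integral_cross_defect:
      "(LINT r|lborel. cross_defect \<alpha> r x y) = \<bar>x * y\<bar> powr (\<alpha> / 2) * sign_weight \<alpha> (sgn (x * y))" (is ?B)
    and integral_abs_cross_defect:
      "(LINT r|lborel. \<bar>cross_defect \<alpha> r x y\<bar>)
        = \<bar>x * y\<bar> powr (\<alpha> / 2) * (LINT r|lborel. \<bar>cross_defect \<alpha> r 1 (sgn (x * y))\<bar>)" (is ?C)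
proof -
  let ?c = "ln \<bar>x\<bar> - ln \<bar>y\<bar>"
  have "?A \<and> ?B \<and> ?C"
  proof (cases "x * y = 0")
    case True
    then show ?thesis by (simp add: cross_defect_eq_0)
  next
    case False
    have e: "\<bar>sgn (x * y)\<bar> = 1" using False by (simp add: abs_sgn_eq)
    have i: "integrable lborel (\<lambda>u. cross_defect \<alpha> u 1 (sgn (x * y)))"
      by (rule integrable_cross_defect[OF \<alpha> e])
    have "integrable lborel (\<lambda>r. cross_defect \<alpha> (?c + 1 * r) 1 (sgn (x * y)))"
      by (rule lborel_integrable_real_affine[OF i]) simp
    moreover have "(LINT r|lborel. cross_defect \<alpha> (?c + 1 * r) 1 (sgn (x * y))) = sign_weight \<alpha> (sgn (x * y))"
      unfolding sign_weight_def by (subst (2) lborel_integral_real_affine[of 1 _ ?c]) auto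
    moreover have "(LINT r|lborel. \<bar>cross_defect \<alpha> (?c + 1 * r) 1 (sgn (x * y))\<bar>)
        = (LINT r|lborel. \<bar>cross_defect \<alpha> r 1 (sgn (x * y))\<bar>)"
      by (subst (2) lborel_integral_real_affine[of 1 _ ?c]) auto
    ultimately show ?thesis
      unfolding cross_defect_scale[OF False] by (simp add: add.commute abs_mult)
  qed
  then show ?A ?B ?C by auto
qed

lemma integrable_powr_mult:
  assumes \<alpha>: "0 < \<alpha>" and f: "f \<in> L_space \<alpha> M" and g: "g \<in> L_space \<alpha> M"
  shows "integrable M (\<lambda>s. \<bar>f s * g s\<bar> powr (\<alpha> / 2))"
proof (rule Bochner_Integration.integrable_bound)
  show "integrable M (\<lambda>s. \<bar>f s\<bar> powr \<alpha> + \<bar>g s\<bar> powr \<alpha>)"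
    using f g by (auto simp: L_space_def)
  have [measurable]: "f \<in> borel_measurable M" "g \<in> borel_measurable M"
    using f g by (auto simp: L_space_def)
  show "(\<lambda>s. \<bar>f s * g s\<bar> powr (\<alpha> / 2)) \<in> borel_measurable M" by measurable
  have "\<bar>x * y\<bar> powr (\<alpha> / 2) \<le> \<bar>x\<bar> powr \<alpha> + \<bar>y\<bar> powr \<alpha>" for x y :: real
  proof -
    have sq: "(\<bar>z\<bar> powr (\<alpha> / 2))\<^sup>2 = \<bar>z\<bar> powr \<alpha>" for z :: real
      by (simp add: power2_eq_square powr_add[symmetric])
    have "2 * (\<bar>x\<bar> powr (\<alpha> / 2) * \<bar>y\<bar> powr (\<alpha> / 2)) \<le> \<bar>x\<bar> powr \<alpha> + \<bar>y\<bar> powr \<alpha>"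
      using sum_squares_bound[of "\<bar>x\<bar> powr (\<alpha> / 2)" "\<bar>y\<bar> powr (\<alpha> / 2)"] by (simp add: sq)
    moreover have "0 \<le> \<bar>x\<bar> powr (\<alpha> / 2) * \<bar>y\<bar> powr (\<alpha> / 2)" by simp
    ultimately show ?thesis unfolding abs_mult powr_mult by linarith
  qed
  then show "AE s in M. norm (\<bar>f s * g s\<bar> powr (\<alpha> / 2)) \<le> norm (\<bar>f s\<bar> powr \<alpha> + \<bar>g s\<bar> powr \<alpha>)"
    by (intro AE_I2) simp
qed

text \<open>The part of \<open>\<integral> \<bar>f g\<bar>\<^sup>\<alpha>\<^sup>/\<^sup>2\<close> that comes from where \<open>f g > 0\<close>; replacing \<open>g\<close> by \<open>- g\<close> gives the part where
  \<open>f g < 0\<close>.\<close>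

definition sign_mass :: "real \<Rightarrow> 's measure \<Rightarrow> ('s \<Rightarrow> real) \<Rightarrow> ('s \<Rightarrow> real) \<Rightarrow> real" where
  "sign_mass \<alpha> M f g = (LINT s|M. max 0 (f s * g s) powr (\<alpha> / 2))"

lemma L_space_uminus: "h \<in> L_space \<alpha> M \<Longrightarrow> (\<lambda>s. - h s) \<in> L_space \<alpha> M"
  by (auto simp: L_space_def)

lemma integrable_sign_mass:
  assumes \<alpha>: "0 < \<alpha>" and f: "f \<in> L_space \<alpha> M" and g: "g \<in> L_space \<alpha> M"
  shows "integrable M (\<lambda>s. max 0 (f s * g s) powr (\<alpha> / 2))"
proof (rule Bochner_Integration.integrable_bound[OF integrable_powr_mult[OF \<alpha> f g]])
  have [measurable]: "f \<in> borel_measurable M" "g \<in> borel_measurable M"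
    using f g by (auto simp: L_space_def)
  show "(\<lambda>s. max 0 (f s * g s) powr (\<alpha> / 2)) \<in> borel_measurable M" by measurable
  show "AE s in M. norm (max 0 (f s * g s) powr (\<alpha> / 2)) \<le> norm (\<bar>f s * g s\<bar> powr (\<alpha> / 2))"
    unfolding real_norm_def abs_of_nonneg[OF powr_ge_zero]
    using \<alpha> by (intro AE_I2 powr_mono2) auto
qed

text \<open>Integrating the defect over \<open>r\<close> first splits it into the two sign masses.  The exchange of
  integrals is justified because the integral of the absolute value of the defect is also a multiple, depending only on the
  sign, of \<open>\<bar>f g\<bar>\<^sup>\<alpha>\<^sup>/\<^sup>2\<close>.\<close>

lemma Fubini_cross_defect:
  assumes \<alpha>: "0 < \<alpha>" "\<alpha> < 2" and M: "sigma_finite_measure M"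
    and f: "f \<in> L_space \<alpha> M" and g: "g \<in> L_space \<alpha> M"
  shows "(LINT r|lborel. LINT s|M. cross_defect \<alpha> r (f s) (g s))
    = sign_weight \<alpha> 1 * sign_mass \<alpha> M f g + sign_weight \<alpha> (- 1) * sign_mass \<alpha> M f (\<lambda>s. - g s)"
proof -
  interpret sigma_finite_measure M by fact
  interpret pair_sigma_finite M lborel
    by unfold_locales
  have [measurable]: "f \<in> borel_measurable M" "g \<in> borel_measurable M"
    using f g by (auto simp: L_space_def)
  note i = integrable_powr_mult[OF \<alpha>(1) f g]
  define C where "C e = (LINT r|lborel. \<bar>cross_defect \<alpha> r 1 e\<bar>)" for e
  have C: "0 \<le> C e" for e unfolding C_def by simp
  have "integrable (M \<Otimes>\<^sub>M lborel) (\<lambda>(s, r). cross_defect \<alpha> r (f s) (g s))"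
  proof (rule Fubini_integrable)
    show "(\<lambda>(s, r). cross_defect \<alpha> r (f s) (g s)) \<in> borel_measurable (M \<Otimes>\<^sub>M lborel)"
      by measurable
    show "AE s in M. integrable lborel (\<lambda>r. case (s, r) of (s, r) \<Rightarrow> cross_defect \<alpha> r (f s) (g s))"
      by (simp add: integrable_cross_defect_scaled[OF \<alpha>])
    have "integrable M (\<lambda>s. LINT r|lborel. \<bar>cross_defect \<alpha> r (f s) (g s)\<bar>)"
    proof (rule Bochner_Integration.integrable_bound[OF integrable_mult_right[OF i, of "C 1 + C (- 1) + C 0"]])
      show "AE s in M. norm (LINT r|lborel. \<bar>cross_defect \<alpha> r (f s) (g s)\<bar>)
          \<le> norm ((C 1 + C (- 1) + C 0) * \<bar>f s * g s\<bar> powr (\<alpha> / 2))"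
      proof (intro AE_I2)
        fix s
        have "C (sgn (f s * g s)) \<le> C 1 + C (- 1) + C 0"
          using C[of 1] C[of "- 1"] C[of 0] by (auto simp: sgn_if)
        moreover have "(LINT r|lborel. \<bar>cross_defect \<alpha> r (f s) (g s)\<bar>)
            = C (sgn (f s * g s)) * \<bar>f s * g s\<bar> powr (\<alpha> / 2)"
          by (subst integral_abs_cross_defect[OF \<alpha>]) (simp add: C_def)
        ultimately show "norm (LINT r|lborel. \<bar>cross_defect \<alpha> r (f s) (g s)\<bar>)
            \<le> norm ((C 1 + C (- 1) + C 0) * \<bar>f s * g s\<bar> powr (\<alpha> / 2))"
          using C[of "sgn (f s * g s)"] by (simp add: abs_mult mult_right_mono)
      qed
    qed measurable
    then show "integrable M (\<lambda>s. LINT r|lborel. norm (case (s, r) of (s, r) \<Rightarrow> cross_defect \<alpha> r (f s) (g s)))"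
      by simp
  qed
  from Fubini_integral[OF this]
  have "(LINT r|lborel. LINT s|M. cross_defect \<alpha> r (f s) (g s))
      = (LINT s|M. \<bar>f s * g s\<bar> powr (\<alpha> / 2) * sign_weight \<alpha> (sgn (f s * g s)))"
    by (simp add: integral_cross_defect[OF \<alpha>])
  also have "\<dots> = (LINT s|M. sign_weight \<alpha> 1 * max 0 (f s * g s) powr (\<alpha> / 2)
      + sign_weight \<alpha> (- 1) * max 0 (f s * - g s) powr (\<alpha> / 2))"
    by (intro Bochner_Integration.integral_cong) (auto simp: sgn_if max_def)
  also have "\<dots> = sign_weight \<alpha> 1 * sign_mass \<alpha> M f g + sign_weight \<alpha> (- 1) * sign_mass \<alpha> M f (\<lambda>s. - g s)"
  proof -
    have "integrable M (\<lambda>s. max 0 (f s * g s) powr (\<alpha> / 2))" "integrable M (\<lambda>s. max 0 (f s * - g s) powr (\<alpha> / 2))"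
      using integrable_sign_mass[OF \<alpha>(1) f] g L_space_uminus[OF g] by blast+
    then show ?thesis
      unfolding sign_mass_def by (subst Bochner_Integration.integral_add) auto
  qed
  finally show ?thesis .
qed

text \<open>For fixed \<open>r\<close> the integrated defect is determined by the \<open>\<alpha>\<close>-norms of linear combinations of \<open>f\<close> and
  \<open>g\<close>, which are what the law of a stable process records.\<close>

lemma integral_cross_defect_norm:
  assumes \<alpha>: "0 < \<alpha>" and f: "f \<in> L_space \<alpha> M" and g: "g \<in> L_space \<alpha> M"
  shows "(LINT s|M. cross_defect \<alpha> r (f s) (g s))
    = exp (\<alpha> * r / 2) * (LINT s|M. \<bar>f s\<bar> powr \<alpha>) + exp (- (\<alpha> * r / 2)) * (LINT s|M. \<bar>g s\<bar> powr \<alpha>)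
      - (LINT s|M. \<bar>exp (r / 2) * f s + exp (- (r / 2)) * g s\<bar> powr \<alpha>)"
proof -
  have [measurable]: "f \<in> borel_measurable M" "g \<in> borel_measurable M"
    and i: "integrable M (\<lambda>s. \<bar>f s\<bar> powr \<alpha>)" "integrable M (\<lambda>s. \<bar>g s\<bar> powr \<alpha>)"
    using f g by (auto simp: L_space_def)
  let ?a = "exp (r / 2)" and ?b = "exp (- (r / 2))"
  have "integrable M (\<lambda>s. \<bar>?a * f s + ?b * g s\<bar> powr \<alpha>)"
  proof (rule Bochner_Integration.integrable_bound)
    show "integrable M (\<lambda>s. (2 * ?a) powr \<alpha> * \<bar>f s\<bar> powr \<alpha> + (2 * ?b) powr \<alpha> * \<bar>g s\<bar> powr \<alpha>)"
      using i by auto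
    have "\<bar>x + y\<bar> powr \<alpha> \<le> \<bar>2 * x\<bar> powr \<alpha> + \<bar>2 * y\<bar> powr \<alpha>" for x y :: real
    proof (cases "\<bar>x\<bar> \<le> \<bar>y\<bar>")
      case True
      then have "\<bar>x + y\<bar> powr \<alpha> \<le> \<bar>2 * y\<bar> powr \<alpha>" using \<alpha> by (intro powr_mono2) auto
      then show ?thesis by (simp add: add_increasing)
    next
      case False
      then have "\<bar>x + y\<bar> powr \<alpha> \<le> \<bar>2 * x\<bar> powr \<alpha>" using \<alpha> by (intro powr_mono2) auto
      then show ?thesis by (simp add: add_increasing2)
    qed
    from this[of "?a * f s" "?b * g s" for s]
    show "AE s in M. norm (\<bar>?a * f s + ?b * g s\<bar> powr \<alpha>)
      \<le> norm ((2 * ?a) powr \<alpha> * \<bar>f s\<bar> powr \<alpha> + (2 * ?b) powr \<alpha> * \<bar>g s\<bar> powr \<alpha>)"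
      by (intro AE_I2) (simp add: abs_mult powr_mult mult.assoc)
  qed measurable
  then show ?thesis unfolding cross_defect_def using i by simp
qed

text \<open>Let \<open>I\<close> and \<open>J\<close> be the masses of \<open>f\<^sub>1 f\<^sub>2 > 0\<close> and \<open>f\<^sub>1 f\<^sub>2 < 0\<close>, and \<open>K\<close> that of \<open>g\<^sub>1 g\<^sub>2 > 0\<close>.
  With the two weights \<open>p\<close> and \<open>q\<close>, equality of norms gives \<open>p I + q J = p K\<close>, and, applied to \<open>- f\<^sub>2\<close> and
  \<open>- g\<^sub>2\<close>, also \<open>p J + q I = q K\<close>.  Eliminating \<open>I\<close> and \<open>K\<close> leaves \<open>(q\<^sup>2 - p\<^sup>2) J = 0\<close>, and
  \<open>\<bar>p\<bar> < q\<close>.\<close>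

lemma AE_mult_nonneg_of_equal_norms:
  assumes \<alpha>: "0 < \<alpha>" "\<alpha> < 2" and M: "sigma_finite_measure M" and N: "sigma_finite_measure N"
    and f: "f\<^sub>1 \<in> L_space \<alpha> M" "f\<^sub>2 \<in> L_space \<alpha> M"
    and g: "g\<^sub>1 \<in> L_space_nonneg \<alpha> N" "g\<^sub>2 \<in> L_space_nonneg \<alpha> N"
    and eq: "\<And>a b. (LINT s|M. \<bar>a * f\<^sub>1 s + b * f\<^sub>2 s\<bar> powr \<alpha>) = (LINT s|N. \<bar>a * g\<^sub>1 s + b * g\<^sub>2 s\<bar> powr \<alpha>)"
  shows "AE s in M. 0 \<le> f\<^sub>1 s * f\<^sub>2 s"
proof -
  have g': "g\<^sub>1 \<in> L_space \<alpha> N" "g\<^sub>2 \<in> L_space \<alpha> N" using g by (auto simp: L_space_nonneg_def)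
  let ?p = "sign_weight \<alpha> 1" and ?q = "sign_weight \<alpha> (- 1)"
  define I J K where "I = sign_mass \<alpha> M f\<^sub>1 f\<^sub>2" and "J = sign_mass \<alpha> M f\<^sub>1 (\<lambda>s. - f\<^sub>2 s)"
    and "K = sign_mass \<alpha> N g\<^sub>1 g\<^sub>2"
  have "(LINT s|N. max 0 (g\<^sub>1 s * - g\<^sub>2 s) powr (\<alpha> / 2)) = (LINT s|N. 0)"
    using g by (intro Bochner_Integration.integral_cong) (auto simp: L_space_nonneg_def max_absorb1)
  then have 0: "sign_mass \<alpha> N g\<^sub>1 (\<lambda>s. - g\<^sub>2 s) = 0" by (simp add: sign_mass_def)
  have "(LINT s|M. cross_defect \<alpha> r (f\<^sub>1 s) (f\<^sub>2 s)) = (LINT s|N. cross_defect \<alpha> r (g\<^sub>1 s) (g\<^sub>2 s))" for r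
    using eq[of 1 0] eq[of 0 1] eq[of "exp (r / 2)" "exp (- (r / 2))"]
    by (simp add: integral_cross_defect_norm[OF \<alpha>(1)] f g')
  with Fubini_cross_defect[OF \<alpha> M f] Fubini_cross_defect[OF \<alpha> N g']
  have 1: "?p * I + ?q * J = ?p * K" by (simp add: I_def J_def K_def 0)
  have "(LINT s|M. cross_defect \<alpha> r (f\<^sub>1 s) (- f\<^sub>2 s)) = (LINT s|N. cross_defect \<alpha> r (g\<^sub>1 s) (- g\<^sub>2 s))" for r
    using eq[of 1 0] eq[of 0 1] eq[of "exp (r / 2)" "- exp (- (r / 2))"]
    by (simp add: integral_cross_defect_norm[OF \<alpha>(1)] f g' L_space_uminus)
  with Fubini_cross_defect[OF \<alpha> M f(1) L_space_uminus[OF f(2)]] Fubini_cross_defect[OF \<alpha> N g'(1) L_space_uminus[OF g'(2)]]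
  have 2: "?p * J + ?q * I = ?q * K" by (simp add: I_def J_def K_def 0)
  have "(?q\<^sup>2 - ?p\<^sup>2) * J = ?q * (?p * I + ?q * J) - ?p * (?p * J + ?q * I)"
    by (simp add: algebra_simps power2_eq_square)
  also have "\<dots> = 0" unfolding 1 2 by simp
  finally have "J = 0"
    using sign_weight_less[OF \<alpha>] power_strict_mono[of "\<bar>?p\<bar>" ?q 2] by auto
  then have "AE s in M. max 0 (f\<^sub>1 s * - f\<^sub>2 s) powr (\<alpha> / 2) = 0"
    using integral_nonneg_eq_0_iff_AE[OF integrable_sign_mass[OF \<alpha>(1) f(1) L_space_uminus[OF f(2)]]]
    by (simp add: J_def sign_mass_def)
  then show ?thesis by eventually_elim (auto simp: max_def split: if_splits)
qed

section \<open>Poisson processes with sigma-finite intensity\<close>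

text \<open>A Poisson number of independent uniform points of \<open>A\<close> is a Poisson process on \<open>A\<close>.  Given
  \<open>n\<close> points, they all avoid \<open>B\<close> with probability \<open>q\<^sup>n\<close>, and the generating function of the
  Poisson distribution with mean \<open>m\<close> at \<open>q\<close> is \<open>e\<^sup>-\<^sup>m\<^sup>(\<^sup>1\<^sup>-\<^sup>q\<^sup>)\<close>.  A sample point \<open>(n, z)\<close> lists infinitely many
  points \<open>z\<close>, of which the first \<open>n\<close> count.\<close>

lemma poisson_void_probability:
  fixes \<nu> :: "'z measure"
  assumes A: "A \<in> sets \<nu>" "emeasure \<nu> A \<noteq> 0" "emeasure \<nu> A \<noteq> \<infinity>"
  defines "Q \<equiv> measure_pmf (poisson_pmf (measure \<nu> A)) \<Otimes>\<^sub>M (\<Pi>\<^sub>M i\<in>(UNIV :: nat set). uniform_measure \<nu> A)"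
  shows "prob_space Q"
    and "B \<in> sets \<nu> \<Longrightarrow> {\<omega> \<in> space Q. snd \<omega> ` {..<fst \<omega>} \<inter> B = {}} \<in> sets Q" (is "_ \<Longrightarrow> ?E \<in> _")
    and "B \<in> sets \<nu> \<Longrightarrow> measure Q {\<omega> \<in> space Q. snd \<omega> ` {..<fst \<omega>} \<inter> B = {}} = exp (- measure \<nu> (A \<inter> B))"
proof -
  define \<pi> where "\<pi> = uniform_measure \<nu> A"
  define m where "m = measure \<nu> A"
  have m: "0 < m" using A unfolding m_def measure_def
    by (simp add: enn2real_positive_iff less_top[symmetric] zero_less_iff_neq_zero)
  interpret \<pi>: prob_space \<pi> unfolding \<pi>_def using A by (intro prob_space_uniform_measure) auto
  interpret Pi: product_prob_space "\<lambda>_. \<pi>" "UNIV :: nat set" by unfold_locales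
  have Q: "Q = measure_pmf (poisson_pmf m) \<Otimes>\<^sub>M (\<Pi>\<^sub>M i\<in>(UNIV :: nat set). \<pi>)"
    by (simp add: Q_def \<pi>_def m_def)
  interpret P: pair_prob_space "measure_pmf (poisson_pmf m)" "\<Pi>\<^sub>M i\<in>(UNIV :: nat set). \<pi>"
    by unfold_locales
  show "prob_space Q" unfolding Q by unfold_locales
  assume B: "B \<in> sets \<nu>"
  then have [measurable]: "B \<in> sets \<pi>" by (simp add: \<pi>_def)
  have E: "?E = {\<omega> \<in> space Q. \<forall>i. i < fst \<omega> \<longrightarrow> snd \<omega> i \<notin> B}" by auto
  show sE: "?E \<in> sets Q" unfolding E unfolding Q by measurable
  define q where "q = measure \<pi> (space \<pi> - B)"
  have "1 - q = measure \<pi> B"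
    unfolding q_def by (subst \<pi>.prob_compl) auto
  also have "\<dots> = measure \<nu> (A \<inter> B) / m"
    unfolding \<pi>_def m_def by (rule measure_uniform_measure) (use A B in auto)
  finally have q: "m * (1 - q) = measure \<nu> (A \<inter> B)" using m by simp
  have "emeasure Q ?E = (\<integral>\<^sup>+ n. emeasure (\<Pi>\<^sub>M i\<in>(UNIV :: nat set). \<pi>) (Pair n -` ?E) \<partial>measure_pmf (poisson_pmf m))"
    unfolding Q by (rule Pi.emeasure_pair_measure_alt) (use sE in \<open>simp add: Q\<close>)
  also have "\<dots> = (\<integral>\<^sup>+ n. ennreal (q ^ n) \<partial>measure_pmf (poisson_pmf m))"
  proof (intro nn_integral_cong)
    fix n
    have "Pair n -` ?E = {x \<in> space (\<Pi>\<^sub>M i\<in>(UNIV :: nat set). \<pi>). \<forall>i\<in>{..<n}. x i \<in> space \<pi> - B}"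
      by (auto simp: Q space_pair_measure space_PiM PiE_iff)
    then show "emeasure (\<Pi>\<^sub>M i\<in>(UNIV :: nat set). \<pi>) (Pair n -` ?E) = ennreal (q ^ n)"
      by (simp only:, subst Pi.emeasure_PiM_Collect)
        (auto simp: q_def \<pi>.emeasure_eq_measure ennreal_power)
  qed
  also have "\<dots> = (\<Sum>n. ennreal (pmf (poisson_pmf m) n * q ^ n))"
    by (simp add: nn_integral_measure_pmf nn_integral_count_space_nat ennreal_mult' del: pmf_poisson)
  also have "\<dots> = (\<Sum>n. ennreal (exp (- m) * ((m * q) ^ n /\<^sub>R fact n)))"
    using m by (simp add: field_simps power_mult_distrib)
  also have "\<dots> = ennreal (exp (- m) * exp (m * q))"
  proof (rule suminf_ennreal_eq)
    show "(\<lambda>n. exp (- m) * ((m * q) ^ n /\<^sub>R fact n)) sums (exp (- m) * exp (m * q))"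
      by (intro sums_mult exp_converges)
    show "0 \<le> exp (- m) * ((m * q) ^ n /\<^sub>R fact n)" for n
      using m by (simp add: q_def)
  qed
  also have "exp (- m) * exp (m * q) = exp (- measure \<nu> (A \<inter> B))"
    unfolding q[symmetric] exp_add[symmetric] by (simp add: algebra_simps)
  finally show "measure Q ?E = exp (- measure \<nu> (A \<inter> B))"
    by (simp add: measure_def)
qed

text \<open>Cut the space into countably many disjoint pieces of finite measure and superpose independent
  Poisson processes on them; pieces of measure \<open>0\<close> are left out, as there is no uniform distribution on them.
  Only the void probabilities of the process matter for suprema over its points, so only these are
  computed.\<close>

lemma (in sigma_finite_measure) poisson_process_exists:
  obtains Q :: "(nat \<Rightarrow> nat \<times> (nat \<Rightarrow> 'a)) measure" and N :: "(nat \<Rightarrow> nat \<times> (nat \<Rightarrow> 'a)) \<Rightarrow> 'a set"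
  where "prob_space Q" "\<And>\<omega>. N \<omega> \<subseteq> space M"
    "\<And>B. B \<in> sets M \<Longrightarrow> {\<omega> \<in> space Q. N \<omega> \<inter> B = {}} \<in> sets Q"
    "\<And>B. B \<in> sets M \<Longrightarrow> emeasure M B \<noteq> \<infinity> \<Longrightarrow> measure Q {\<omega> \<in> space Q. N \<omega> \<inter> B = {}} = exp (- measure M B)"
proof -
  obtain A :: "nat \<Rightarrow> 'a set" where A: "range A \<subseteq> sets M" "(\<Union>i. A i) = space M"
    "\<And>i. emeasure M (A i) \<noteq> \<infinity>" "disjoint_family A"
    using sigma_finite_disjoint by blast
  have [measurable]: "A i \<in> sets M" for i using A(1) by auto
  define K where "K = {k. emeasure M (A k) \<noteq> 0}"
  define R where "R k = measure_pmf (poisson_pmf (measure M (A k))) \<Otimes>\<^sub>M (\<Pi>\<^sub>M i\<in>(UNIV :: nat set). uniform_measure M (A k))" for k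
  define Q where "Q = PiM K R"
  define N where "N \<omega> = (\<Union>k\<in>K. snd (\<omega> k) ` {..<fst (\<omega> k)}) \<inter> space M" for \<omega> :: "nat \<Rightarrow> nat \<times> (nat \<Rightarrow> 'a)"
  define E where "E k B = {x \<in> space (R k). snd x ` {..<fst x} \<inter> B = {}}" for k B
  have R: "prob_space (R k)" "\<And>B. B \<in> sets M \<Longrightarrow> E k B \<in> sets (R k)"
    "\<And>B. B \<in> sets M \<Longrightarrow> measure (R k) (E k B) = exp (- measure M (A k \<inter> B))" if "k \<in> K" for k
    using that poisson_void_probability[of "A k" M] A(3)[of k] by (auto simp: R_def K_def E_def)
  interpret Q: prob_space Q unfolding Q_def by (rule prob_space_PiM) (rule R)
  \<comment> \<open>Only finitely many coordinates are controlled at a time; void events are decreasing limits of these.\<close>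
  define F where "F B n = {\<omega> \<in> space Q. \<forall>k\<in>K \<inter> {..<n}. \<omega> k \<in> E k B}" for B and n :: nat
  have void: "{\<omega> \<in> space Q. N \<omega> \<inter> B = {}} = (\<Inter>n. F B n)" if "B \<in> sets M" for B
  proof (intro equalityI subsetI)
    fix \<omega> assume "\<omega> \<in> {\<omega> \<in> space Q. N \<omega> \<inter> B = {}}"
    then have \<omega>: "\<omega> \<in> space Q" "N \<omega> \<inter> B = {}" by auto
    have "\<omega> k \<in> E k B" if "k \<in> K" for k
      using \<omega> that sets.sets_into_space[OF \<open>B \<in> sets M\<close>] unfolding E_def N_def
      by (auto simp: Q_def space_PiM PiE_iff; blast)
    then show "\<omega> \<in> (\<Inter>n. F B n)" using \<omega> by (simp add: F_def)
  next
    fix \<omega> assume "\<omega> \<in> (\<Inter>n. F B n)"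
    then have \<omega>: "\<omega> \<in> F B (Suc k)" for k by auto
    have "\<omega> k \<in> E k B" if "k \<in> K" for k using \<omega>[of k] that by (auto simp: F_def)
    moreover have "\<omega> \<in> space Q" using \<omega>[of 0] by (simp add: F_def)
    ultimately show "\<omega> \<in> {\<omega> \<in> space Q. N \<omega> \<inter> B = {}}" by (auto simp: E_def N_def)
  qed
  have F: "F B n = prod_emb K R (K \<inter> {..<n}) (Pi\<^sub>E (K \<inter> {..<n}) (\<lambda>k. E k B))" if "B \<in> sets M" for B n
    using that by (auto simp: F_def prod_emb_def Q_def space_PiM PiE_iff extensional_def)
  have F_sets: "F B n \<in> sets Q" if "B \<in> sets M" for B n
    unfolding F[OF that] Q_def using R that by (intro sets_PiM_I) auto
  have F_measure: "measure Q (F B n) = exp (- (\<Sum>k<n. measure M (A k \<inter> B)))" if B: "B \<in> sets M" for B n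
  proof -
    have "emeasure Q (F B n) = (\<Prod>k\<in>K \<inter> {..<n}. emeasure (R k) (E k B))"
      unfolding F[OF B] Q_def using R B by (intro emeasure_PiM_emb) auto
    also have "\<dots> = (\<Prod>k\<in>K \<inter> {..<n}. ennreal (exp (- measure M (A k \<inter> B))))"
      using R B by (intro prod.cong) (auto simp: finite_measure.emeasure_eq_measure prob_space.finite_measure)
    also have "\<dots> = ennreal (exp (- (\<Sum>k\<in>K \<inter> {..<n}. measure M (A k \<inter> B))))"
      by (simp add: prod_ennreal exp_sum[symmetric] sum_negf)
    also have "(\<Sum>k\<in>K \<inter> {..<n}. measure M (A k \<inter> B)) = (\<Sum>k<n. measure M (A k \<inter> B))"
    proof (rule sum.mono_neutral_left)
      have "emeasure M (A k \<inter> B) = 0" if "k \<notin> K" for k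
        using that B emeasure_mono[of "A k \<inter> B" "A k" M] by (simp add: K_def)
      then have "measure M (A k \<inter> B) = 0" if "k \<notin> K" for k using that by (simp add: measure_def)
      then show "\<forall>k\<in>{..<n} - K \<inter> {..<n}. measure M (A k \<inter> B) = 0"
        by auto
    qed auto
    finally show ?thesis by (simp add: measure_def)
  qed
  show thesis
  proof (rule that)
    show "prob_space Q" by unfold_locales
    show "N \<omega> \<subseteq> space M" for \<omega> by (auto simp: N_def)
    fix B assume B: "B \<in> sets M"
    show "{\<omega> \<in> space Q. N \<omega> \<inter> B = {}} \<in> sets Q"
      unfolding void[OF B] using F_sets[OF B] by auto
    assume fin: "emeasure M B \<noteq> \<infinity>"
    have "(\<lambda>k. measure M (A k \<inter> B)) sums measure M (\<Union>k. A k \<inter> B)"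
    proof (rule measure_UNION)
      show "disjoint_family (\<lambda>k. A k \<inter> B)" using A(4) by (auto simp: disjoint_family_on_def)
      have "emeasure M (\<Union>k. A k \<inter> B) \<le> emeasure M B" using B by (intro emeasure_mono) auto
      then show "emeasure M (\<Union>k. A k \<inter> B) \<noteq> \<infinity>" using fin by (auto simp: top_unique)
    qed (use B in auto)
    moreover have "(\<Union>k. A k \<inter> B) = B" using A(2) sets.sets_into_space[OF B] by auto
    ultimately have "(\<lambda>n. exp (- (\<Sum>k<n. measure M (A k \<inter> B)))) \<longlonglongrightarrow> exp (- measure M B)"
      by (auto simp: sums_def intro!: tendsto_intros)
    moreover have "(\<lambda>n. measure Q (F B n)) \<longlonglongrightarrow> measure Q (\<Inter>n. F B n)"
      by (rule Q.finite_Lim_measure_decseq) (use F_sets[OF B] in \<open>auto simp: decseq_def F_def\<close>)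
    ultimately show "measure Q {\<omega> \<in> space Q. N \<omega> \<inter> B = {}} = exp (- measure M B)"
      unfolding void[OF B] F_measure[OF B] by (rule LIMSEQ_unique[symmetric])
  qed
qed

section \<open>Existence of extremal integrals\<close>

lemma powr_Max_le_sum:
  fixes x :: "nat \<Rightarrow> real"
  assumes "0 < n"
  shows "(MAX j\<in>{..<n}. x j) powr \<alpha> \<le> (\<Sum>j<n. x j powr \<alpha>)"
proof -
  have "(MAX j\<in>{..<n}. x j) \<in> x ` {..<n}" using assms by (intro Max_in) auto
  then obtain j where "j < n" "(MAX j\<in>{..<n}. x j) = x j" by auto
  then show ?thesis using member_le_sum[of j "{..<n}" "\<lambda>j. x j powr \<alpha>"] by simp
qed

lemma less_powr_iff_mult_powr_gt:
  fixes x a c :: real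
  assumes "0 < \<alpha>" "0 \<le> x" "0 < a" "0 < c"
  shows "a < x * c powr (- (1 / \<alpha>)) \<longleftrightarrow> c < (x / a) powr \<alpha>"
proof (cases "x = 0")
  case False
  define d where "d = c powr (1 / \<alpha>)"
  have d: "0 < d" "d powr \<alpha> = c" using assms by (simp_all add: d_def powr_powr)
  have "a < x * c powr (- (1 / \<alpha>)) \<longleftrightarrow> d < x / a"
    using assms d by (simp add: powr_minus d_def[symmetric] field_simps)
  also have "\<dots> \<longleftrightarrow> d powr \<alpha> < (x / a) powr \<alpha>"
  proof
    show "d < x / a \<Longrightarrow> d powr \<alpha> < (x / a) powr \<alpha>" using assms d(1) by (intro powr_less_mono2) auto
    have "x / a \<le> d \<Longrightarrow> (x / a) powr \<alpha> \<le> d powr \<alpha>" using assms by (intro powr_mono2) auto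
    then show "d powr \<alpha> < (x / a) powr \<alpha> \<Longrightarrow> d < x / a" by linarith
  qed
  finally show ?thesis by (simp add: d)
qed (use assms in auto)

text \<open>Let \<open>N\<close> be a Poisson process whose intensity is the product of \<open>M\<close> and Lebesgue measure, and let
  \<open>Y\<^sub>t\<close> be the supremum of \<open>c\<^sup>-\<^sup>1\<^sup>/\<^sup>\<alpha> g\<^sub>t(s)\<close> over its points \<open>(s, c)\<close> with \<open>c > 0\<close>.  Then \<open>Y\<^sub>t\<^sub>j \<le> a\<^sub>j\<close> for all \<open>j\<close> iff no point \<open>(s, c)\<close> satisfies
  \<open>0 < c < h(s)\<close> for \<open>h = (max\<^sub>j g\<^sub>t\<^sub>j / a\<^sub>j)\<^sup>\<alpha>\<close>, and this region below the graph of \<open>h\<close> has measure \<open>\<integral> h dM\<close>.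
  Suprema are formed in the extended nonnegative reals (\<open>V\<close>) and are almost surely finite.\<close>

lemma extremal_process_exists:
  fixes M :: "'s measure" and g :: "'t \<Rightarrow> 's \<Rightarrow> real"
  assumes \<alpha>: "0 < \<alpha>" and M: "sigma_finite_measure M" and g: "\<And>t. t \<in> T \<Longrightarrow> g t \<in> L_space_nonneg \<alpha> M"
  obtains Q :: "(nat \<Rightarrow> nat \<times> (nat \<Rightarrow> 's \<times> real)) measure" and Y
  where "real_process Q T Y" "\<And>t \<omega>. 0 \<le> Y t \<omega>" "eq_extremal_integral \<alpha> T Q Y M g"
proof -
  interpret M: sigma_finite_measure M by fact
  interpret pair_sigma_finite M lborel by unfold_locales
  interpret P: sigma_finite_measure "M \<Otimes>\<^sub>M (lborel :: real measure)" by (rule sigma_finite_measure_axioms)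
  have gm: "g t \<in> borel_measurable M" and gi: "integrable M (\<lambda>s. g t s powr \<alpha>)"
    and g0: "\<And>s. s \<in> space M \<Longrightarrow> 0 \<le> g t s" if "t \<in> T" for t
    using g[OF that] by (auto simp: L_space_nonneg_def L_space_def cong: Bochner_Integration.integrable_cong)
  let ?\<nu> = "M \<Otimes>\<^sub>M (lborel :: real measure)"
  obtain Q :: "(nat \<Rightarrow> nat \<times> (nat \<Rightarrow> 's \<times> real)) measure" and N
    where Q: "prob_space Q" and N: "\<And>\<omega>. N \<omega> \<subseteq> space ?\<nu>"
    and void: "\<And>B. B \<in> sets ?\<nu> \<Longrightarrow> {\<omega> \<in> space Q. N \<omega> \<inter> B = {}} \<in> sets Q"
      "\<And>B. B \<in> sets ?\<nu> \<Longrightarrow> emeasure ?\<nu> B \<noteq> \<infinity>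
        \<Longrightarrow> measure Q {\<omega> \<in> space Q. N \<omega> \<inter> B = {}} = exp (- measure ?\<nu> B)"
    by (rule P.poisson_process_exists) (assumption | rule that)+
  interpret Q: prob_space Q by fact
  \<comment> \<open>Points with \<open>c \<le> 0\<close> are made harmless by the value \<open>0\<close>, so that all of \<open>lborel\<close> can serve as
    the second factor.\<close>
  define \<psi> where "\<psi> t = (\<lambda>(s, c). if 0 < c then g t s * c powr (- (1 / \<alpha>)) else 0)" for t and c :: real
  define V where "V t \<omega> = (SUP p\<in>N \<omega>. ennreal (\<psi> t p))" for t \<omega>
  define Y where "Y t \<omega> = enn2real (V t \<omega>)" for t \<omega>
  have \<psi>m [measurable]: "\<psi> t \<in> borel_measurable ?\<nu>" if "t \<in> T" for t
  proof -
    have [measurable]: "g t \<in> borel_measurable M" by (rule gm[OF that])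
    show ?thesis unfolding \<psi>_def by measurable
  qed
  have Vm [measurable]: "V t \<in> borel_measurable Q" if t: "t \<in> T" for t
  proof (rule borel_measurableI_le)
    fix y
    have [measurable]: "\<psi> t \<in> borel_measurable ?\<nu>" by (rule \<psi>m[OF t])
    have "{p \<in> space ?\<nu>. y < ennreal (\<psi> t p)} \<in> sets ?\<nu>" by measurable
    note void(1)[OF this]
    also have "{\<omega> \<in> space Q. N \<omega> \<inter> {p \<in> space ?\<nu>. y < ennreal (\<psi> t p)} = {}} = {\<omega> \<in> space Q. V t \<omega> \<le> y}"
      using N by (auto simp: V_def SUP_le_iff disjoint_iff not_less subset_iff)
    finally show "{\<omega> \<in> space Q. V t \<omega> \<le> y} \<in> sets Q" .
  qed
  have V_le: "measure Q {\<omega> \<in> space Q. \<forall>j<n. V (t j) \<omega> \<le> ennreal (a j)}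
      = exp (- (LINT s|M. (MAX j\<in>{..<n}. g (t j) s / a j) powr \<alpha>))"
    if n: "0 < n" and t: "\<And>j. j < n \<Longrightarrow> 0 < a j \<and> t j \<in> T" for n :: nat and a t
  proof -
    define h where "h s = (MAX j\<in>{..<n}. g (t j) s / a j) powr \<alpha>" for s
    define B where "B = {p \<in> space ?\<nu>. \<exists>j<n. a j < \<psi> (t j) p}"
    have h0: "0 \<le> h s" for s by (simp add: h_def)
    have [measurable]: "h \<in> borel_measurable M"
      unfolding h_def using t n
      by (intro powr_real_measurable borel_measurable_const borel_measurable_Max borel_measurable_divide gm) auto
    have hi: "integrable M h"
    proof (rule Bochner_Integration.integrable_bound)
      show "integrable M (\<lambda>s. \<Sum>j<n. g (t j) s powr \<alpha> / a j powr \<alpha>)"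
        using t by (intro Bochner_Integration.integrable_sum integrable_divide gi) auto
      show "AE s in M. norm (h s) \<le> norm (\<Sum>j<n. g (t j) s powr \<alpha> / a j powr \<alpha>)"
      proof (rule AE_I2)
        fix s assume s: "s \<in> space M"
        have "h s \<le> (\<Sum>j<n. (g (t j) s / a j) powr \<alpha>)"
          unfolding h_def using n by (rule powr_Max_le_sum)
        also have "\<dots> = (\<Sum>j<n. g (t j) s powr \<alpha> / a j powr \<alpha>)"
          by (simp add: powr_divide)
        finally show "norm (h s) \<le> norm (\<Sum>j<n. g (t j) s powr \<alpha> / a j powr \<alpha>)"
          using h0[of s] by simp
      qed
    qed simp
    have "B = {p \<in> space ?\<nu>. \<exists>j\<in>{..<n}. a j < \<psi> (t j) p}" by (auto simp: B_def)
    also have "\<dots> \<in> sets ?\<nu>"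
      using t by (intro sets.sets_Collect_finite_Ex borel_measurable_less \<psi>m) auto
    finally have Bm: "B \<in> sets ?\<nu>" .
    have slice: "Pair s -` B = {0<..<h s}" if s: "s \<in> space M" for s
    proof -
      have "(s, c) \<in> B \<longleftrightarrow> 0 < c \<and> c < h s" for c
      proof (cases "0 < c")
        case True
        have "(s, c) \<in> B \<longleftrightarrow> (\<exists>j<n. c < (g (t j) s / a j) powr \<alpha>)"
          using s t True g0 \<alpha>
          by (auto simp: B_def \<psi>_def space_pair_measure less_powr_iff_mult_powr_gt)
        also have "\<dots> \<longleftrightarrow> c < h s"
        proof
          assume "\<exists>j<n. c < (g (t j) s / a j) powr \<alpha>"
          then obtain j where j: "j < n" "c < (g (t j) s / a j) powr \<alpha>" by auto
          moreover have "(g (t j) s / a j) powr \<alpha> \<le> h s"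
            unfolding h_def using j t s g0 \<alpha> by (intro powr_mono2 Max_ge) (auto simp: less_imp_le)
          ultimately show "c < h s" by simp
        next
          assume "c < h s"
          moreover have "(MAX j\<in>{..<n}. g (t j) s / a j) \<in> (\<lambda>j. g (t j) s / a j) ` {..<n}"
            using n by (intro Max_in) auto
          ultimately show "\<exists>j<n. c < (g (t j) s / a j) powr \<alpha>" by (auto simp: h_def)
        qed
        finally show ?thesis using True by simp
      next
        case False
        then show ?thesis using t by (auto simp: B_def \<psi>_def dest: less_asym)
      qed
      then show ?thesis by (intro set_eqI) (simp only: vimage_eq greaterThanLessThan_iff)
    qed
    have "emeasure ?\<nu> B = (\<integral>\<^sup>+ s. emeasure lborel (Pair s -` B) \<partial>M)"
      by (rule lborel.emeasure_pair_measure_alt[OF Bm])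
    also have "\<dots> = (\<integral>\<^sup>+ s. ennreal (h s) \<partial>M)"
      by (intro nn_integral_cong) (simp add: slice h0)
    also have "\<dots> = ennreal (LINT s|M. h s)"
      by (rule nn_integral_eq_integral[OF hi]) (simp add: h0)
    finally have B: "emeasure ?\<nu> B = ennreal (LINT s|M. h s)" .
    have "{\<omega> \<in> space Q. \<forall>j<n. V (t j) \<omega> \<le> ennreal (a j)} = {\<omega> \<in> space Q. N \<omega> \<inter> B = {}}"
    proof -
      have "(V (t j) \<omega> \<le> ennreal (a j)) \<longleftrightarrow> (\<forall>p\<in>N \<omega>. \<psi> (t j) p \<le> a j)" if "j < n" for j \<omega>
        using t[OF that] by (simp add: V_def SUP_le_iff ennreal_le_iff less_imp_le)
      then show ?thesis using N by (auto simp: B_def disjoint_iff not_less subset_iff) (meson not_less)+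
    qed
    then show ?thesis
      using void(2)[OF Bm] B h0 unfolding h_def[symmetric] by (simp add: measure_def Bochner_Integration.integral_nonneg)
  qed
  have V_finite: "AE \<omega> in Q. V t \<omega> \<noteq> \<infinity>" if t: "t \<in> T" for t
  proof -
    have [measurable]: "V t \<in> borel_measurable Q" by (rule Vm[OF t])
    define I where "I = (LINT s|M. g t s powr \<alpha>)"
    have "Q.prob {\<omega> \<in> space Q. V t \<omega> \<noteq> \<infinity>} \<ge> exp (- (I * real (Suc n) powr (- \<alpha>)))" for n
    proof -
      have "(LINT s|M. (MAX j\<in>{..<Suc 0}. g t s / real (Suc n)) powr \<alpha>) = (LINT s|M. g t s powr \<alpha> * real (Suc n) powr (- \<alpha>))"
        using g0[OF t] by (intro Bochner_Integration.integral_cong) (auto simp: powr_divide powr_minus field_simps lessThan_Suc)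
      then have "exp (- (I * real (Suc n) powr (- \<alpha>))) = Q.prob {\<omega> \<in> space Q. V t \<omega> \<le> ennreal (real (Suc n))}"
        using V_le[of "Suc 0" "\<lambda>_. real (Suc n)" "\<lambda>_. t"] t by (simp add: I_def)
      also have "\<dots> \<le> Q.prob {\<omega> \<in> space Q. V t \<omega> \<noteq> \<infinity>}"
        by (intro Q.finite_measure_mono) (auto simp: top_unique)
      finally show ?thesis .
    qed
    moreover have "(\<lambda>n. exp (- (I * real (Suc n) powr (- \<alpha>)))) \<longlonglongrightarrow> exp (- (I * 0))"
      using \<alpha> by (intro tendsto_exp tendsto_minus tendsto_mult tendsto_const
        tendsto_neg_powr[of "- \<alpha>"] filterlim_compose[OF filterlim_real_sequentially filterlim_Suc]) auto
    ultimately have "exp (- (I * 0)) \<le> Q.prob {\<omega> \<in> space Q. V t \<omega> \<noteq> \<infinity>}"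
      by (intro LIMSEQ_le_const2) auto
    then have "Q.prob {\<omega> \<in> space Q. V t \<omega> \<noteq> \<infinity>} = 1" using Q.prob_le_1 by (simp add: antisym)
    then show ?thesis by (subst Q.prob_Collect_eq_1[symmetric]) auto
  qed
  show thesis
  proof (rule that[of Q Y])
    show "0 \<le> Y t \<omega>" for t \<omega> by (simp add: Y_def)
    have Ym: "Y t \<in> borel_measurable Q" if "t \<in> T" for t
      unfolding Y_def using Vm[OF that] by measurable
    then show "real_process Q T Y" by (simp add: real_process_def Q)
    show "eq_extremal_integral \<alpha> T Q Y M g"
      unfolding eq_extremal_integral_def
    proof (intro allI impI, elim conjE)
      fix n :: nat and a :: "nat \<Rightarrow> real" and t :: "nat \<Rightarrow> 't"
      assume n: "0 < n" and t: "\<forall>j<n. 0 < a j \<and> t j \<in> T"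
      have "AE \<omega> in Q. \<forall>j\<in>{..<n}. V (t j) \<omega> \<noteq> \<infinity>"
        using t V_finite by (intro AE_finite_allI) auto
      then have "AE \<omega> in Q. \<omega> \<in> {\<omega> \<in> space Q. \<forall>j<n. Y (t j) \<omega> \<le> a j}
          \<longleftrightarrow> \<omega> \<in> {\<omega> \<in> space Q. \<forall>j<n. V (t j) \<omega> \<le> ennreal (a j)}"
      proof eventually_elim
        case (elim \<omega>)
        have "Y (t j) \<omega> \<le> a j \<longleftrightarrow> V (t j) \<omega> \<le> ennreal (a j)" if "j < n" for j
        proof -
          have "V (t j) \<omega> = ennreal (Y (t j) \<omega>)" using elim that by (simp add: Y_def less_top)
          then show ?thesis using t that by (simp add: ennreal_le_iff less_imp_le)
        qed
        then show ?case by auto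
      qed
      moreover have "{\<omega> \<in> space Q. \<forall>j\<in>{..<n}. Y (t j) \<omega> \<le> a j} \<in> sets Q"
        "{\<omega> \<in> space Q. \<forall>j\<in>{..<n}. V (t j) \<omega> \<le> ennreal (a j)} \<in> sets Q"
        using t by (intro sets.sets_Collect_finite_All borel_measurable_le Ym Vm; auto)+
      ultimately have "Q.prob {\<omega> \<in> space Q. \<forall>j<n. Y (t j) \<omega> \<le> a j}
          = Q.prob {\<omega> \<in> space Q. \<forall>j<n. V (t j) \<omega> \<le> ennreal (a j)}"
        by (intro Q.finite_measure_eq_AE) (simp_all only: Ball_def lessThan_iff)
      also have "\<dots> = exp (- (LINT s|M. (MAX j\<in>{..<n}. g (t j) s / a j) powr \<alpha>))"
        using n t by (intro V_le) auto
      finally show "Q.prob {\<omega> \<in> space Q. \<forall>j<n. Y (t j) \<omega> \<le> a j}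
          = exp (- (LINT s|M. (MAX j\<in>{..<n}. g (t j) s / a j) powr \<alpha>))" .
    qed
  qed
qed

lemma frechet_process_of_extremal_integral:
  fixes T :: "'t set"
  assumes \<alpha>: "0 < \<alpha>" and Y: "real_process Q T Y" "\<And>t \<omega>. 0 \<le> Y t \<omega>" and ex: "eq_extremal_integral \<alpha> T Q Y M g"
  shows "frechet_process \<alpha> Q T Y"
  unfolding frechet_process_def
proof (intro conjI allI impI Y, elim conjE)
  fix n :: nat and a :: "nat \<Rightarrow> real" and t :: "nat \<Rightarrow> 't"
  assume n: "0 < n" and t: "\<forall>j<n. 0 < a j \<and> t j \<in> T"
  define I where "I = (LINT s|M. (MAX j\<in>{..<n}. a j * g (t j) s) powr \<alpha>)"
  have "0 \<le> I" by (simp add: I_def Bochner_Integration.integral_nonneg)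
  then have \<sigma>: "(I powr (1 / \<alpha>)) powr \<alpha> = I" using \<alpha> by (simp add: powr_powr)
  show "frechet_rv \<alpha> Q (\<lambda>\<omega>. MAX j\<in>{..<n}. a j * Y (t j) \<omega>)"
    unfolding frechet_rv_def
  proof (intro conjI exI[of _ "I powr (1 / \<alpha>)"] allI impI AE_I2)
    show "0 \<le> (MAX j\<in>{..<n}. a j * Y (t j) \<omega>)" for \<omega>
      using n t Y(2) by (subst Max_ge_iff) (auto intro!: bexI[of _ 0] simp: less_imp_le)
    fix x :: real assume x: "0 < x"
    have "{\<omega> \<in> space Q. (MAX j\<in>{..<n}. a j * Y (t j) \<omega>) \<le> x} = {\<omega> \<in> space Q. \<forall>j<n. Y (t j) \<omega> \<le> x / a j}"
      using n t by (subst Max_le_iff) (auto simp: field_simps)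
    then have "measure Q {\<omega> \<in> space Q. (MAX j\<in>{..<n}. a j * Y (t j) \<omega>) \<le> x}
        = exp (- (LINT s|M. (MAX j\<in>{..<n}. g (t j) s / (x / a j)) powr \<alpha>))"
      using ex n t x by (simp add: eq_extremal_integral_def)
    also have "(LINT s|M. (MAX j\<in>{..<n}. g (t j) s / (x / a j)) powr \<alpha>)
        = (LINT s|M. (MAX j\<in>{..<n}. a j * g (t j) s) powr \<alpha> * x powr (- \<alpha>))"
    proof (intro Bochner_Integration.integral_cong refl)
      fix s
      have "mono (\<lambda>y. y / x)" using x by (simp add: mono_def divide_right_mono)
      then have "(MAX j\<in>{..<n}. a j * g (t j) s) / x = (MAX y\<in>(\<lambda>j. a j * g (t j) s) ` {..<n}. y / x)"
        using n by (intro mono_Max_commute) auto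
      also have "\<dots> = (MAX j\<in>{..<n}. g (t j) s / (x / a j))"
        by (simp add: image_image mult.commute)
      finally have eq: "(MAX j\<in>{..<n}. a j * g (t j) s) / x = (MAX j\<in>{..<n}. g (t j) s / (x / a j))" .
      show "(MAX j\<in>{..<n}. g (t j) s / (x / a j)) powr \<alpha> = (MAX j\<in>{..<n}. a j * g (t j) s) powr \<alpha> * x powr (- \<alpha>)"
        unfolding eq[symmetric] by (simp add: powr_divide powr_minus_divide)
    qed
    finally show "measure Q {\<omega> \<in> space Q. (MAX j\<in>{..<n}. a j * Y (t j) \<omega>) \<le> x}
        = exp (- ((I powr (1 / \<alpha>)) powr \<alpha> * x powr (- \<alpha>)))"
      unfolding \<sigma> by (simp add: I_def)
  qed simp
qed

lemma max_associable_of_nonneg_representation: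
  fixes M :: "'s measure" and g :: "'t \<Rightarrow> 's \<Rightarrow> real"
  assumes \<alpha>: "0 < \<alpha>" and X: "sas_process \<alpha> P T X" and M: "sigma_finite_measure M"
    and g: "\<And>t. t \<in> T \<Longrightarrow> g t \<in> L_space_nonneg \<alpha> M" and st: "eq_stable_integral \<alpha> T P X M g"
  shows "max_associable \<alpha> T P X"
proof -
  obtain Q :: "(nat \<Rightarrow> nat \<times> (nat \<Rightarrow> 's \<times> real)) measure" and Y
    where Y: "real_process Q T Y" "\<And>t \<omega>. 0 \<le> Y t \<omega>" and ex: "eq_extremal_integral \<alpha> T Q Y M g"
    by (rule extremal_process_exists[OF \<alpha> M g]) (assumption | rule that)+
  have "associated_via \<alpha> T P X Q Y M g"
    using M g st ex by (simp add: associated_via_def)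
  moreover have "frechet_process \<alpha> Q T Y"
    using frechet_process_of_extremal_integral[OF \<alpha> Y(1) _ ex] Y(2) by blast
  ultimately show ?thesis
    using max_associableI[OF associatedI[OF X]] by blast
qed

section \<open>Sign-compatible representations\<close>

text \<open>The hypothesis says that all \<open>x j\<close> have the same weak sign, and an overall sign disappears in the
  absolute value.\<close>

lemma abs_sum_eq_abs_sum_abs:
  fixes a x :: "nat \<Rightarrow> real"
  assumes "\<And>i j. i < n \<Longrightarrow> j < n \<Longrightarrow> 0 \<le> x i * x j"
  shows "\<bar>\<Sum>j<n. a j * x j\<bar> = \<bar>\<Sum>j<n. a j * \<bar>x j\<bar>\<bar>"
proof (cases "\<forall>j<n. 0 \<le> x j")
  case False
  then obtain i where i: "i < n" "x i < 0" by (auto simp: not_le)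
  have "x j = - \<bar>x j\<bar>" if "j < n" for j
    using assms[OF i(1) that] i by (auto simp: zero_le_mult_iff)
  then have "(\<Sum>j<n. a j * x j) = (\<Sum>j<n. - (a j * \<bar>x j\<bar>))"
    by (intro sum.cong) (auto, metis mult_minus_right)
  then show ?thesis by (simp add: sum_negf)
qed (auto intro!: sum.cong arg_cong[where f = abs])

text \<open>Although the exceptional null set depends on the pair \<open>t\<^sub>1, t\<^sub>2\<close> and \<open>T\<close> may be uncountable, finite-dimensional
  distributions involve finitely many pairs at a time.\<close>

lemma eq_stable_integral_abs:
  assumes "eq_stable_integral \<alpha> T P X M f" and f: "\<And>t. t \<in> T \<Longrightarrow> f t \<in> borel_measurable M"
    and sign: "\<forall>t\<^sub>1\<in>T. \<forall>t\<^sub>2\<in>T. AE s in M. f t\<^sub>1 s * f t\<^sub>2 s \<ge> 0"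
  shows "eq_stable_integral \<alpha> T P X M (\<lambda>t s. \<bar>f t s\<bar>)"
proof -
  have "(LINT s|M. \<bar>\<Sum>j<n. a j * f (t j) s\<bar> powr \<alpha>) = (LINT s|M. \<bar>\<Sum>j<n. a j * \<bar>f (t j) s\<bar>\<bar> powr \<alpha>)"
    if t: "\<forall>j<n. t j \<in> T" for n :: nat and a t
  proof (rule integral_cong_AE)
    have "AE s in M. \<forall>i\<in>{..<n}. \<forall>j\<in>{..<n}. 0 \<le> f (t i) s * f (t j) s"
      using t sign by (intro AE_finite_allI) auto
    then show "AE s in M. \<bar>\<Sum>j<n. a j * f (t j) s\<bar> powr \<alpha> = \<bar>\<Sum>j<n. a j * \<bar>f (t j) s\<bar>\<bar> powr \<alpha>"
      by eventually_elim (subst abs_sum_eq_abs_sum_abs, auto)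
  qed (use t in \<open>intro powr_real_measurable borel_measurable_const borel_measurable_abs borel_measurable_sum
      borel_measurable_times f; simp\<close>)+
  then show ?thesis using assms(1) by (simp add: eq_stable_integral_def)
qed

lemma eq_stable_integral_norm_eq:
  assumes "eq_stable_integral \<alpha> T P X M f" "eq_stable_integral \<alpha> T P X N g" "t\<^sub>1 \<in> T" "t\<^sub>2 \<in> T"
  shows "(LINT s|M. \<bar>a * f t\<^sub>1 s + b * f t\<^sub>2 s\<bar> powr \<alpha>) = (LINT s|N. \<bar>a * g t\<^sub>1 s + b * g t\<^sub>2 s\<bar> powr \<alpha>)"
proof -
  let ?a = "\<lambda>j::nat. if j = 0 then a else b" and ?t = "\<lambda>j::nat. if j = 0 then t\<^sub>1 else t\<^sub>2"
  have *: "(LINT \<omega>|P. exp (- \<i> * of_real (\<Sum>j<2. ?a j * X (?t j) \<omega>)))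
      = of_real (exp (- (LINT s|K. \<bar>\<Sum>j<2. ?a j * h (?t j) s\<bar> powr \<alpha>)))"
    if "eq_stable_integral \<alpha> T P X K h" for K :: "'x measure" and h
    by (rule that[unfolded eq_stable_integral_def, rule_format]) (simp add: assms(3,4))
  from trans[OF *[OF assms(1), symmetric] *[OF assms(2)]]
  have "exp (- (LINT s|M. \<bar>\<Sum>j<2. ?a j * f (?t j) s\<bar> powr \<alpha>)) = exp (- (LINT s|N. \<bar>\<Sum>j<2. ?a j * g (?t j) s\<bar> powr \<alpha>))"
    by (simp only: of_real_eq_iff)
  then show ?thesis by (simp add: numeral_2_eq_2)
qed

theorem theorem4p2:
  fixes \<alpha> :: real and T :: "'t set"
    and P :: "'w measure" and X :: "'t \<Rightarrow> 'w \<Rightarrow> real"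
    and M :: "'s measure" and f :: "'t \<Rightarrow> 's \<Rightarrow> real"
  assumes "0 < \<alpha>" and "\<alpha> < 2"
    and "sas_process \<alpha> P T X"
    and "sigma_finite_measure M"
    and "\<And>t. t \<in> T \<Longrightarrow> f t \<in> L_space \<alpha> M"
    and "eq_stable_integral \<alpha> T P X M f"
  shows "max_associable \<alpha> T P X \<longleftrightarrow>
    (\<forall>t\<^sub>1\<in>T. \<forall>t\<^sub>2\<in>T. AE s in M. f t\<^sub>1 s * f t\<^sub>2 s \<ge> 0)"
proof
  assume "max_associable \<alpha> T P X"
  then obtain N :: "('t option \<Rightarrow> real) measure" and g where N: "sigma_finite_measure N"
    and g: "\<And>t. t \<in> T \<Longrightarrow> g t \<in> L_space_nonneg \<alpha> N" and eq: "eq_stable_integral \<alpha> T P X N g"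
    unfolding max_associable_def associated_def associated_via_def by blast
  show "\<forall>t\<^sub>1\<in>T. \<forall>t\<^sub>2\<in>T. AE s in M. f t\<^sub>1 s * f t\<^sub>2 s \<ge> 0"
  proof (intro ballI)
    fix t\<^sub>1 t\<^sub>2 assume t: "t\<^sub>1 \<in> T" "t\<^sub>2 \<in> T"
    show "AE s in M. f t\<^sub>1 s * f t\<^sub>2 s \<ge> 0"
      using assms(5) g t eq_stable_integral_norm_eq[OF assms(6) eq t]
      by (intro AE_mult_nonneg_of_equal_norms[OF assms(1,2,4) N, of "f t\<^sub>1" "f t\<^sub>2" "g t\<^sub>1" "g t\<^sub>2"])
  qed
next
  assume sign: "\<forall>t\<^sub>1\<in>T. \<forall>t\<^sub>2\<in>T. AE s in M. f t\<^sub>1 s * f t\<^sub>2 s \<ge> 0"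
  show "max_associable \<alpha> T P X"
  proof (rule max_associable_of_nonneg_representation[OF assms(1,3,4)])
    show "(\<lambda>s. \<bar>f t s\<bar>) \<in> L_space_nonneg \<alpha> M" if "t \<in> T" for t
      using assms(5)[OF that] by (auto simp: L_space_nonneg_def L_space_def)
    show "eq_stable_integral \<alpha> T P X M (\<lambda>t s. \<bar>f t s\<bar>)"
      using assms(5) by (intro eq_stable_integral_abs assms(6) sign) (auto simp: L_space_def)
  qed
qed

end
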